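(* Let $m\ge 1$, $0\le \alpha<mn$, $1<p_1,\dots,p_m<\infty$, $\frac1p=\frac1{p_1}+\cdots+\frac1{p_m}$, $\frac1q=\frac1p-\frac{\alpha}{n}$, and suppose $q\ge \max_i p_i$. Let $w_1,\dots,w_m,v$ be weights on $\mathbb{R}^n$ and set $\sigma_i=w_i^{1-p_i'}$, $i=1,\dots,m$. Define \[ [\vec{w},v]_{S_{\vec{P},q}}:=\sup_{Q}\frac{\left(\int_{Q}\mathcal{M}_\alpha(\sigma_1 1_Q,\dots,\sigma_m 1_Q)^q\, v\,dx\right)^{1/q}}{\prod_{i=1}^m \sigma_i(Q)^{1/p_i}}, \] the supremum taken over all cubes $Q\subset\mathbb{R}^n$. Then $\mathcal{M}_\alpha$ is bounded from $L^{p_1}(w_1)\times\cdots\times L^{p_m}(w_m)$ to $L^q(v)$ if and only if $[\vec{w},v]_{S_{\vec{P},q}}<\infty$. Moreover, \[ \|\mathcal{M}_\alpha\|_{L^{p_1}(w_1)\times\cdots\times L^{p_m}(w_m)\to L^q(v)}\asymp[\vec{w},v]_{S_{\vec{P},q}}, \] with implicit constants independent of the weights.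
   Context: A weight is a non-negative locally integrable function on $\mathbb{R}^n$. For a weight $w$, $L^p(w)$ denotes $L^p(\mathbb{R}^n, w\,dx)$, and $\sigma(Q)=\int_Q\sigma\,dx$. $p'$ denotes the dual exponent, $1/p+1/p'=1$. Cubes have sides parallel to the axes. For $0\le\alpha<mn$, the multilinear fractional maximal operator is \[ \mathcal{M}_\alpha(f_1,\dots,f_m)(x)=\sup_{Q\ni x}\prod_{i=1}^m\frac{1}{|Q|^{1-\alpha/(mn)}}\int_Q|f_i(y_i)|\,dy_i, \] the supremum over cubes $Q$ containing $x$.
   Formalization: The weights w_i are additionally assumed positive almost everywhere and the σ_i locally integrable; otherwise σ_i(Q) can be infinite and the quotient in the testing constant becomes ∞/∞. *)

theory Defs
  imports "HOL-Analysis.Analysis"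
begin

definition epow :: "ennreal \<Rightarrow> real \<Rightarrow> ennreal" where
  "epow x r = (if x = \<infinity> then \<infinity> else ennreal (enn2real x powr r))"

definition cube :: "'a::euclidean_space set \<Rightarrow> bool" where
  "cube Q \<longleftrightarrow> (\<exists>a h. h > 0 \<and> Q = cbox a (a + h *\<^sub>R One))"

definition weight :: "('a::euclidean_space \<Rightarrow> real) \<Rightarrow> bool" where
  "weight w \<longleftrightarrow> (\<forall>x. 0 \<le> w x) \<and> (\<forall>K. compact K \<longrightarrow> set_integrable lborel K w)"

definition Mfrac :: "nat \<Rightarrow> real \<Rightarrow> (nat \<Rightarrow> 'a::euclidean_space \<Rightarrow> ennreal) \<Rightarrow> 'a \<Rightarrow> ennreal" where
  "Mfrac m \<alpha> f x = (SUP Q \<in> {Q. cube Q \<and> x \<in> Q}.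
      \<Prod>i<m. ennreal (measure lborel Q powr (\<alpha> / (real m * real DIM('a)) - 1))
              * (\<integral>\<^sup>+ y\<in>Q. f i y \<partial>lborel))"

definition Lpnorm :: "real \<Rightarrow> ('a::euclidean_space \<Rightarrow> real) \<Rightarrow> ('a \<Rightarrow> ennreal) \<Rightarrow> ennreal" where
  "Lpnorm p w g = epow (\<integral>\<^sup>+ x. epow (g x) p * ennreal (w x) \<partial>lborel) (1 / p)"

text \<open>Operator norm of \<open>\<M>_\<alpha>\<close> from \<open>L^{p_1}(w_1)\<times>\<dots>\<times>L^{p_m}(w_m)\<close> to \<open>L^q(v)\<close>
  (equal to \<open>\<infinity>\<close> iff the operator is unbounded).\<close>
definition Mnorm :: "nat \<Rightarrow> real \<Rightarrow> (nat \<Rightarrow> real) \<Rightarrow> real \<Rightarrow> (nat \<Rightarrow> 'a::euclidean_space \<Rightarrow> real)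
    \<Rightarrow> ('a \<Rightarrow> real) \<Rightarrow> ennreal" where
  "Mnorm m \<alpha> p q w v = Inf {C. \<forall>f::nat \<Rightarrow> 'a \<Rightarrow> real.
      (\<forall>i<m. f i \<in> borel_measurable lborel
          \<and> Lpnorm (p i) (w i) (\<lambda>x. ennreal \<bar>f i x\<bar>) < \<infinity>) \<longrightarrow>
      Lpnorm q v (Mfrac m \<alpha> (\<lambda>i x. ennreal \<bar>f i x\<bar>))
        \<le> C * (\<Prod>i<m. Lpnorm (p i) (w i) (\<lambda>x. ennreal \<bar>f i x\<bar>))}"

definition dualexp :: "real \<Rightarrow> real" where
  "dualexp p = p / (p - 1)"

definition sigw :: "real \<Rightarrow> ('a \<Rightarrow> real) \<Rightarrow> 'a \<Rightarrow> real" where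
  "sigw p w x = w x powr (1 - dualexp p)"

definition Sconst :: "nat \<Rightarrow> real \<Rightarrow> (nat \<Rightarrow> real) \<Rightarrow> real \<Rightarrow> (nat \<Rightarrow> 'a::euclidean_space \<Rightarrow> real)
    \<Rightarrow> ('a \<Rightarrow> real) \<Rightarrow> ennreal" where
  "Sconst m \<alpha> p q w v = (SUP Q \<in> {Q. cube Q}.
      epow (\<integral>\<^sup>+ x\<in>Q. epow (Mfrac m \<alpha> (\<lambda>i y. ennreal (sigw (p i) (w i) y * indicator Q y)) x) q
                          * ennreal (v x) \<partial>lborel) (1 / q)
      / (\<Prod>i<m. epow (\<integral>\<^sup>+ x\<in>Q. ennreal (sigw (p i) (w i) x) \<partial>lborel) (1 / p i)))"

end

theory Submission
  imports Defs
begin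

text \<open>
  Necessity is testing on \<open>f i = \<sigma> i * indicator Q\<close>. For sufficiency, substitute \<open>f i = g i * \<sigma> i\<close>.
  Every cube lies in a comparable cube of one of finitely many shifted dyadic grids (one-third trick),
  so it suffices to bound the dyadic maximal operator over a finite family \<open>F\<close> of cubes. Choosing for each
  point a cube where the maximum is attained gives disjoint sets \<open>A Q \<subseteq> Q\<close> and turns the \<open>q\<close>-th power of the
  norm into \<open>\<Sum>Q\<in>F. lam Q * (\<Prod>i<m. a i Q ^ q)\<close>, where \<open>a i Q\<close> is the \<open>\<sigma> i\<close>-average of \<open>g i\<close>; the testing
  condition says \<open>\<Sum>Q\<subseteq>R. lam Q \<le> B * (\<Prod>i<m. \<sigma> i R ^ (q / p i))\<close>. This Carleson sum is split into layers
  \<open>2 ^ k i \<le> a i Q\<close>, one exponent for each \<open>i\<close>. In every layer only the maximal cubes matter, and since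
  \<open>q / p i \<ge> 1\<close> the sum over them of \<open>\<Prod>i. \<sigma> i R ^ (q / p i)\<close> is at most \<open>\<Prod>i. (\<Sum>R. \<sigma> i R) ^ (q / p i)\<close>.
  The sum over the layers then factorises into \<open>m\<close> one-function maximal estimates.
\<close>

subsection \<open>Powers of extended nonnegative reals\<close>

lemma epow_top [simp]: "epow \<infinity> r = \<infinity>" "epow top r = top"
  by (auto simp: epow_def)

lemma epow_ennreal: "0 \<le> x \<Longrightarrow> epow (ennreal x) r = ennreal (x powr r)"
  by (simp add: epow_def)

lemma epow_0 [simp]: "epow 0 r = 0"
  by (simp add: epow_def)

lemma epow_1_right [simp]: "epow x 1 = x"
  by (cases x) (auto simp: epow_ennreal)

lemma epow_1_left [simp]: "epow 1 r = 1"
  by (simp add: epow_def)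

lemma epow_mono: "x \<le> y \<Longrightarrow> 0 \<le> r \<Longrightarrow> epow x r \<le> epow y r"
  by (cases x; cases y) (auto simp: epow_ennreal top_unique intro!: ennreal_leI powr_mono2)

lemma epow_epow: "epow (epow x r) s = epow x (r * s)"
  by (cases x) (auto simp: epow_ennreal powr_powr)

lemma epow_mult: "0 < r \<Longrightarrow> epow (x * y) r = epow x r * epow y r"
proof -
  assume r: "0 < r"
  have *: "epow (top * y) r = top * epow y r" for y
  proof (cases y)
    case (real s)
    then show ?thesis using r by (cases "s = 0") (auto simp: epow_ennreal ennreal_top_mult)
  qed (auto)
  show ?thesis
  proof (cases x)
    case (real a)
    show ?thesis
    proof (cases y)
      case top then show ?thesis using *[of x] by (simp add: mult.commute)
    next
      case (real b)
      then show ?thesis using \<open>x = ennreal a\<close> \<open>0 \<le> a\<close>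
        by (simp add: epow_ennreal powr_mult flip: ennreal_mult)
    qed
  qed (use * in auto)
qed

lemma epow_prod: "0 < r \<Longrightarrow> epow (\<Prod>i\<in>A. f i) r = (\<Prod>i\<in>A. epow (f i) r)"
  by (induction A rule: infinite_finite_induct) (auto simp: epow_mult)

lemma epow_le_iff: "0 < r \<Longrightarrow> epow x r \<le> y \<longleftrightarrow> x \<le> epow y (1 / r)"
  using epow_mono[of "epow x r" y "1/r"] epow_mono[of x "epow y (1/r)" r]
  by (auto simp: epow_epow)

text \<open>For positive \<open>r\<close> the power is an order isomorphism with inverse exponent
  \<open>1 / r\<close>, by \<open>epow_le_iff\<close>, and therefore commutes with suprema.\<close>

lemma epow_SUP: "0 < r \<Longrightarrow> epow (SUP i\<in>I. f i) r = (SUP i\<in>I. epow (f i) r)"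
  by (intro antisym SUP_least epow_mono SUP_upper)
     (auto simp: epow_le_iff intro!: SUP_least order.trans[OF _ epow_mono[OF SUP_upper]] simp: epow_epow)

lemma epow_eq_top_iff [simp]: "epow x r = top \<longleftrightarrow> x = top"
  by (cases x) (auto simp: epow_ennreal)

lemma epow_less_top: "x < top \<Longrightarrow> epow x r < top"
  by (simp add: less_top[symmetric])

text \<open>Each of \<open>a\<close>, \<open>b\<close> is at most \<open>a + b\<close>, so
  \<open>c powr r \<le> c * (a + b) powr (r - 1)\<close> for both; adding the two gives the claim.
  This superadditivity is where \<open>p i \<le> q\<close> enters, with
  \<open>r = q / p i\<close>.\<close>

lemma epow_add_le: "1 \<le> r \<Longrightarrow> epow x r + epow y r \<le> epow (x + y) r"
proof (cases x; cases y)
  fix a b assume r: "1 \<le> r" and *: "x = ennreal a" "0 \<le> a" "y = ennreal b" "0 \<le> b"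
  have **: "c powr r \<le> c * (a + b) powr (r - 1)" if "0 \<le> c" "c \<le> a + b" for c
  proof (cases "c = 0")
    case False
    then have "c powr r = c * c powr (r - 1)" using that by (simp add: powr_diff)
    then show ?thesis using that r by (auto intro!: mult_left_mono powr_mono2)
  qed (use r in auto)
  have "(a + b) powr r = (a + b) * (a + b) powr (r - 1)"
    using * r by (cases "a + b = 0") (auto simp: powr_diff)
  then have "a powr r + b powr r \<le> (a + b) powr r"
    using **[of a] **[of b] * by (simp add: algebra_simps)
  then show ?thesis using * by (simp add: epow_ennreal flip: ennreal_plus)
qed auto

lemma epow_sum_le: "1 \<le> r \<Longrightarrow> (\<Sum>i\<in>A. epow (f i) r) \<le> epow (\<Sum>i\<in>A. f i) r"
  by (induction A rule: infinite_finite_induct)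
     (auto intro: order.trans[OF add_left_mono epow_add_le])

lemma borel_measurable_epow [measurable]: "(\<lambda>x. epow x r) \<in> borel_measurable borel"
  unfolding epow_def by measurable

text \<open>The left side is the diagonal of the expanded right side. For empty \<open>I\<close> the
  left side would be the cardinality of \<open>A\<close> against 1.\<close>

lemma sum_prod_le_prod_sum:
  fixes f :: "'i \<Rightarrow> 'b \<Rightarrow> ennreal"
  assumes "finite I" "I \<noteq> {}" "finite A"
  shows "(\<Sum>x\<in>A. \<Prod>i\<in>I. f i x) \<le> (\<Prod>i\<in>I. \<Sum>x\<in>A. f i x)"
  using assms(1,2)
proof (induction I rule: finite_ne_induct)
  case (insert j I)
  have "(\<Sum>x\<in>A. \<Prod>i\<in>insert j I. f i x) = (\<Sum>x\<in>A. f j x * (\<Prod>i\<in>I. f i x))"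
    using insert by simp
  also have "\<dots> \<le> (\<Sum>x\<in>A. f j x * (\<Sum>x\<in>A. \<Prod>i\<in>I. f i x))"
    using assms by (intro sum_mono mult_left_mono member_le_sum) auto
  also have "\<dots> = (\<Sum>x\<in>A. f j x) * (\<Sum>x\<in>A. \<Prod>i\<in>I. f i x)"
    by (simp add: sum_distrib_right)
  also have "\<dots> \<le> (\<Sum>x\<in>A. f j x) * (\<Prod>i\<in>I. \<Sum>x\<in>A. f i x)"
    by (intro mult_left_mono insert.IH) auto
  finally show ?case using insert by simp
qed simp

text \<open>Exponents may be negative, so the largest one is factored out; the remaining sum runs
  over distinct powers of \<open>1/x\<close> and is at most the full series
  \<open>x / (x - 1)\<close>.\<close>

lemma geometric_sum_int_le:
  fixes x B :: real and K :: "int set"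
  assumes "finite K" "1 < x" and B: "\<And>k. k \<in> K \<Longrightarrow> x powr k \<le> B" "0 \<le> B"
  shows "(\<Sum>k\<in>K. x powr k) \<le> B * (x / (x - 1))"
proof (cases "K = {}")
  case False
  define n where "n = Max K"
  have n: "n \<in> K" "\<And>k. k \<in> K \<Longrightarrow> k \<le> n" using assms(1) False by (auto simp: n_def)
  have "(\<Sum>k\<in>K. x powr k) = (\<Sum>k\<in>K. x powr n * (1/x) ^ nat (n - k))"
  proof (rule sum.cong)
    fix k assume "k \<in> K"
    then have "real (nat (n - k)) = n - k" using n by simp
    then have "(1/x) ^ nat (n - k) = (1/x) powr (n - k)"
      using assms(2) by (subst powr_realpow[symmetric]) auto
    also have "\<dots> = x powr (k - n)" using assms(2) by (simp add: powr_divide powr_minus_divide[symmetric])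
    finally show "x powr k = x powr n * (1/x) ^ nat (n - k)"
      using assms(2) by (simp flip: powr_add)
  qed simp
  also have "\<dots> = x powr n * (\<Sum>j\<in>(\<lambda>k. nat (n - k)) ` K. (1/x) ^ j)"
    using n by (subst sum.reindex) (auto simp: inj_on_def sum_distrib_left eq_nat_nat_iff)
  also have "\<dots> \<le> x powr n * (\<Sum>j. (1/x) ^ j)"
    using assms by (intro mult_left_mono sum_le_suminf summable_geometric) auto
  also have "\<dots> = x powr n * (x / (x - 1))"
    using assms by (subst suminf_geometric) (auto simp: field_simps)
  also have "\<dots> \<le> B * (x / (x - 1))"
    using assms n by (intro mult_right_mono) auto
  finally show ?thesis .
qed (use assms in auto)

lemma ennreal_mult_top_pos: "0 < c \<Longrightarrow> ennreal c * top = top"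
  by (simp add: ennreal_mult_top)

text \<open>Pointwise core of the maximal estimate, as in Marcinkiewicz interpolation. Only levels
  with \<open>2 powr k < 2 * g\<close> survive, and there the summand is
  \<open>2 * g * x powr k\<close> with ratio \<open>x = 2 powr (p - 1) > 1\<close>. The top level
  dominates the geometric sum and contributes \<open>(2 * g) powr (p - 1)\<close>.\<close>

lemma layer_sum_le:
  fixes g :: ennreal and p :: real
  assumes "finite K" "1 < p"
  shows "(\<Sum>k\<in>K. ennreal (2 powr (p * real_of_int k)) *
      (ennreal (2 / 2 powr k) * (g * indicator {y. ennreal (2 powr k / 2) < y} g)))
    \<le> ennreal (2 * 2 powr (p - 1) * (2 powr (p - 1) / (2 powr (p - 1) - 1))) * epow g p"
proof (cases g)
  case top
  have "(1::real) < 2 powr (p - 1)" using assms(2) by simp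
  then have "0 < 2 * 2 powr (p - 1) * (2 powr (p - 1) / (2 powr (p - 1) - 1))" by simp
  then have "ennreal (2 * 2 powr (p - 1) * (2 powr (p - 1) / (2 powr (p - 1) - 1))) * top = top"
    by (rule ennreal_mult_top_pos)
  then show ?thesis by (simp only: top epow_top top_greatest)
next
  case (real a)
  define x :: real where "x = 2 powr (p - 1)"
  have x: "1 < x" using assms by (simp add: x_def)
  define L where "L = {k \<in> K. 2 powr real_of_int k < 2 * a}"
  have "(\<Sum>k\<in>K. ennreal (2 powr (p * real_of_int k)) *
      (ennreal (2 / 2 powr k) * (g * indicator {y. ennreal (2 powr k / 2) < y} g)))
     = (\<Sum>k\<in>L. ennreal (2 * a * x powr k))"
    unfolding L_def
  proof (intro sum.mono_neutral_cong_right ballI, goal_cases)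
    case (3 k)
    then show ?case using real by (auto simp: indicator_def ennreal_less_iff)
  next
    case (4 k)
    then have i: "indicator {y. ennreal (2 powr k / 2) < y} g = (1::ennreal)"
      using real by (auto simp: indicator_def ennreal_less_iff)
    have "2 powr (p * real_of_int k) * (2 / 2 powr k * a) = 2 * a * x powr k"
      unfolding x_def powr_powr by (simp add: algebra_simps powr_diff)
    then show ?case unfolding i using real
      by (simp flip: ennreal_mult)
  qed (use assms in auto)
  also have "\<dots> = ennreal (2 * a * (\<Sum>k\<in>L. x powr k))"
    using real by (subst sum_ennreal) (auto simp: sum_distrib_left)
  also have "\<dots> \<le> ennreal (2 * a * ((2 * a) powr (p - 1) * (x / (x - 1))))"
  proof (intro ennreal_leI mult_left_mono geometric_sum_int_le)
    fix k assume "k \<in> L"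
    then have "2 powr real_of_int k \<le> 2 * a" by (simp add: L_def)
    then have "(2 powr real_of_int k) powr (p - 1) \<le> (2 * a) powr (p - 1)"
      using assms by (intro powr_mono2) auto
    then show "x powr k \<le> (2 * a) powr (p - 1)"
      by (simp add: x_def powr_powr mult.commute)
  qed (use assms x real in \<open>auto simp: L_def\<close>)
  also have "2 * a * ((2 * a) powr (p - 1) * (x / (x - 1))) = 2 * x * (x / (x - 1)) * a powr p"
    using real assms by (cases "a = 0") (auto simp: x_def powr_mult powr_diff)
  also have "ennreal \<dots> = ennreal (2 * x * (x / (x - 1))) * epow g p"
    using real x by (subst ennreal_mult) (auto simp: epow_ennreal)
  finally show ?thesis unfolding x_def .
qed

subsection \<open>A multilinear Carleson embedding\<close>

text \<open>The part of \<open>g\<close> below \<open>t / 2\<close> contributes at most half of \<open>t * emeasure M Q\<close>, which is absorbed.\<close>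

lemma emeasure_le_truncated:
  fixes t :: real
  assumes [measurable]: "Q \<in> sets M" "g \<in> borel_measurable M"
    and fin: "emeasure M Q < \<infinity>" and t: "0 < t"
    and le: "ennreal t * emeasure M Q \<le> (\<integral>\<^sup>+x\<in>Q. g x \<partial>M)"
  shows "emeasure M Q \<le> ennreal (2 / t) *
    (\<integral>\<^sup>+x\<in>Q. (g x * indicator {y. ennreal (t / 2) < y} (g x)) \<partial>M)" (is "_ \<le> _ * ?I")
proof -
  obtain s where s: "emeasure M Q = ennreal s" "0 \<le> s"
    using fin by (cases "emeasure M Q") auto
  have "(\<integral>\<^sup>+x\<in>Q. g x \<partial>M) \<le> (\<integral>\<^sup>+x. (g x * indicator {y. ennreal (t / 2) < y} (g x)) * indicator Q x
      + ennreal (t / 2) * indicator Q x \<partial>M)"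
    by (intro nn_integral_mono) (auto simp: indicator_def not_less)
  also have "\<dots> = ?I + ennreal (t / 2) * emeasure M Q"
    by (subst nn_integral_add) (auto simp: nn_integral_cmult_indicator)
  finally have *: "ennreal t * emeasure M Q \<le> ?I + ennreal (t / 2) * emeasure M Q"
    using le by simp
  show ?thesis
  proof (cases ?I)
    case (real r)
    then have "t * s \<le> r + t / 2 * s"
      using * t s by (simp flip: ennreal_mult ennreal_plus)
    then have "s \<le> 2 / t * r" using t by (simp add: field_simps)
    then show ?thesis using real s t by (simp flip: ennreal_mult)
  qed (use t in \<open>auto simp: ennreal_mult_top\<close>)
qed

text \<open>A weak-type estimate: the truncated bound holds on each set, and disjointness merges the
  integrals over the sets into one. Keeping only the large values of \<open>g\<close> is what later
  allows summation over all levels \<open>t\<close>.\<close>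

lemma sum_emeasure_le_truncated:
  fixes t :: real
  assumes G: "finite G" "disjoint G" "G \<subseteq> sets M"
    and [measurable]: "g \<in> borel_measurable M"
    and fin: "\<And>Q. Q \<in> G \<Longrightarrow> emeasure M Q < \<infinity>" and t: "0 < t"
    and le: "\<And>Q. Q \<in> G \<Longrightarrow> ennreal t * emeasure M Q \<le> (\<integral>\<^sup>+x\<in>Q. g x \<partial>M)"
  shows "(\<Sum>Q\<in>G. emeasure M Q) \<le> ennreal (2 / t) *
    (\<integral>\<^sup>+x. g x * indicator {y. ennreal (t / 2) < y} (g x) \<partial>M)"
proof -
  let ?h = "\<lambda>x. g x * indicator {y. ennreal (t / 2) < y} (g x)"
  have "(\<Sum>Q\<in>G. emeasure M Q) \<le> (\<Sum>Q\<in>G. ennreal (2 / t) * (\<integral>\<^sup>+x\<in>Q. ?h x \<partial>M))"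
    using G fin t le by (intro sum_mono emeasure_le_truncated) auto
  also have "\<dots> = ennreal (2 / t) * (\<integral>\<^sup>+x. (\<Sum>Q\<in>G. ?h x * indicator Q x) \<partial>M)"
    using G by (subst nn_integral_sum) (auto simp: sum_distrib_left subset_iff)
  also have "\<dots> \<le> ennreal (2 / t) * (\<integral>\<^sup>+x. ?h x \<partial>M)"
  proof (intro mult_left_mono nn_integral_mono)
    fix x
    have "(\<Sum>Q\<in>G. ?h x * indicator Q x) = ?h x * (\<Sum>Q\<in>G. indicator Q x)"
      by (simp add: sum_distrib_left)
    also have "(\<Sum>Q\<in>G. indicator Q x) = (indicator (\<Union>G) x :: ennreal)"
    proof -
      have "indicator (\<Union>((\<lambda>Q. Q) ` G)) x = (\<Sum>Q\<in>G. indicator Q x :: ennreal)"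
        using G by (intro indicator_UN_disjoint) (auto simp: disjoint_family_on_def disjoint_def)
      then show ?thesis by simp
    qed
    also have "?h x * \<dots> \<le> ?h x" by (auto simp: indicator_def)
    finally show "(\<Sum>Q\<in>G. ?h x * indicator Q x) \<le> ?h x" .
  qed simp
  finally show ?thesis .
qed

lemma sum_UN_le:
  fixes f :: "'a \<Rightarrow> ennreal"
  assumes "finite H" "\<And>R. R \<in> H \<Longrightarrow> finite (S R)"
  shows "(\<Sum>x\<in>(\<Union>R\<in>H. S R). f x) \<le> (\<Sum>R\<in>H. \<Sum>x\<in>S R. f x)"
  using assms
proof (induction H rule: finite_induct)
  case (insert R H)
  have "(\<Sum>x\<in>(\<Union>R\<in>insert R H. S R). f x) \<le> (\<Sum>x\<in>S R. f x) + (\<Sum>x\<in>(\<Union>R\<in>H. S R). f x)"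
  proof -
    let ?U = "\<Union>R\<in>H. S R"
    have fin: "finite (S R)" "finite ?U" using insert by auto
    have "(\<Sum>x\<in>S R \<union> (?U - S R). f x) = (\<Sum>x\<in>S R. f x) + (\<Sum>x\<in>?U - S R. f x)"
      using fin by (intro sum.union_disjoint) auto
    moreover have "(\<Sum>x\<in>?U - S R. f x) \<le> (\<Sum>x\<in>?U. f x)"
      using fin by (intro sum_mono2) auto
    ultimately show ?thesis by (simp add: add_left_mono)
  qed
  also have "\<dots> \<le> (\<Sum>x\<in>S R. f x) + (\<Sum>R\<in>H. \<Sum>x\<in>S R. f x)"
    using insert by (intro add_left_mono) auto
  finally show ?case using insert by simp
qed simp

text \<open>\<open>H\<close> consists of the inclusion-maximal members. Finiteness puts every member
  below a maximal one, and laminarity makes distinct maximal ones disjoint.\<close>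

lemma sum_le_sum_maximal:
  fixes lam B :: "'a set \<Rightarrow> ennreal"
  assumes "finite G"
    and laminar: "\<And>Q R. Q \<in> G \<Longrightarrow> R \<in> G \<Longrightarrow> Q \<inter> R = {} \<or> Q \<subseteq> R \<or> R \<subseteq> Q"
    and le: "\<And>R. R \<in> G \<Longrightarrow> (\<Sum>Q\<in>{Q\<in>G. Q \<subseteq> R}. lam Q) \<le> B R"
  obtains H where "H \<subseteq> G" "disjoint H" "(\<Sum>Q\<in>G. lam Q) \<le> (\<Sum>R\<in>H. B R)"
proof
  define H where "H = {R \<in> G. \<forall>S\<in>G. R \<subseteq> S \<longrightarrow> R = S}"
  show "H \<subseteq> G" by (auto simp: H_def)
  show "disjoint H" unfolding disjoint_def
  proof (intro ballI impI)
    fix Q R assume "Q \<in> H" "R \<in> H" "Q \<noteq> R"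
    then show "Q \<inter> R = {}" using laminar[of Q R] by (auto simp: H_def)
  qed
  have "G = (\<Union>R\<in>H. {Q\<in>G. Q \<subseteq> R})"
  proof (intro equalityI subsetI)
    fix Q assume "Q \<in> G"
    with finite_has_maximal2[OF assms(1) this] show "Q \<in> (\<Union>R\<in>H. {Q\<in>G. Q \<subseteq> R})"
      by (auto simp: H_def)
  qed auto
  then have "(\<Sum>Q\<in>G. lam Q) = (\<Sum>Q\<in>(\<Union>R\<in>H. {Q\<in>G. Q \<subseteq> R}). lam Q)" by simp
  also have "\<dots> \<le> (\<Sum>R\<in>H. \<Sum>Q\<in>{Q\<in>G. Q \<subseteq> R}. lam Q)"
    using assms(1) by (intro sum_UN_le) (auto simp: H_def)
  also have "\<dots> \<le> (\<Sum>R\<in>H. B R)"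
    using \<open>H \<subseteq> G\<close> by (intro sum_mono le) auto
  finally show "(\<Sum>Q\<in>G. lam Q) \<le> (\<Sum>R\<in>H. B R)" .
qed

text \<open>Constant of \<open>layer_sum_le\<close>: 2 from the truncation weight
  \<open>2 / t\<close>, \<open>2 powr (p - 1)\<close> from the cutoff at \<open>2 * g\<close>, and
  the sum of the geometric series.\<close>

definition layer_const :: "real \<Rightarrow> real" where
  "layer_const p = 2 * 2 powr (p - 1) * (2 powr (p - 1) / (2 powr (p - 1) - 1))"

lemma layer_const_pos: "1 < p \<Longrightarrow> 0 < layer_const p"
  by (simp add: layer_const_def)

text \<open>Up to the factor \<open>2 powr q\<close>, the weight of level \<open>k\<close> is
  \<open>2 powr (p * k)\<close> raised to \<open>q / p\<close>. Superadditivity moves the exponent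
  \<open>q / p\<close> outside the sum over levels, which then enters the integral, where the
  pointwise bound \<open>layer_sum_le\<close> applies.\<close>

lemma truncated_sum_le:
  assumes [measurable]: "g \<in> borel_measurable M" and K: "finite K" and p: "1 < p" "p \<le> q"
  shows "(\<Sum>k\<in>K. ennreal (2 powr (q * (real_of_int k + 1))) *
      epow (ennreal (2 / 2 powr real_of_int k) *
        (\<integral>\<^sup>+x. g x * indicator {y. ennreal (2 powr k / 2) < y} (g x) \<partial>M)) (q / p))
    \<le> ennreal (2 powr q * layer_const p powr (q / p)) * epow (\<integral>\<^sup>+x. epow (g x) p \<partial>M) (q / p)"
proof -
  let ?h = "\<lambda>k x. g x * indicator {y. ennreal (2 powr real_of_int k / 2) < y} (g x)"
  have pos: "0 < q / p" "1 \<le> q / p" using p by auto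
  have "(\<Sum>k\<in>K. ennreal (2 powr (q * (real_of_int k + 1))) *
      epow (ennreal (2 / 2 powr real_of_int k) * (\<integral>\<^sup>+x. ?h k x \<partial>M)) (q / p))
     = ennreal (2 powr q) * (\<Sum>k\<in>K. epow (ennreal (2 powr (p * k)) *
          (ennreal (2 / 2 powr real_of_int k) * (\<integral>\<^sup>+x. ?h k x \<partial>M))) (q / p))"
    unfolding sum_distrib_left
  proof (rule sum.cong)
    fix k assume "k \<in> K"
    have "ennreal (2 powr (q * (real_of_int k + 1))) = ennreal (2 powr q) * epow (ennreal (2 powr (p * k))) (q / p)"
      using p by (simp add: epow_ennreal powr_powr distrib_left powr_add mult.commute[of q] flip: ennreal_mult)
    then show "ennreal (2 powr (q * (real_of_int k + 1))) *
      epow (ennreal (2 / 2 powr real_of_int k) * (\<integral>\<^sup>+x. ?h k x \<partial>M)) (q / p) =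
      ennreal (2 powr q) * epow (ennreal (2 powr (p * k)) *
          (ennreal (2 / 2 powr real_of_int k) * (\<integral>\<^sup>+x. ?h k x \<partial>M))) (q / p)"
      using pos by (simp only: epow_mult mult.assoc)
  qed simp
  also have "\<dots> \<le> ennreal (2 powr q) * epow (\<Sum>k\<in>K. ennreal (2 powr (p * k)) *
          (ennreal (2 / 2 powr real_of_int k) * (\<integral>\<^sup>+x. ?h k x \<partial>M))) (q / p)"
    using pos by (intro mult_left_mono epow_sum_le) auto
  also have "(\<Sum>k\<in>K. ennreal (2 powr (p * k)) *
          (ennreal (2 / 2 powr real_of_int k) * (\<integral>\<^sup>+x. ?h k x \<partial>M)))
     = (\<integral>\<^sup>+x. (\<Sum>k\<in>K. ennreal (2 powr (p * k)) * (ennreal (2 / 2 powr real_of_int k) * ?h k x)) \<partial>M)"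
    by (subst nn_integral_sum) (auto simp: nn_integral_cmult)
  also have "ennreal (2 powr q) * epow \<dots> (q / p)
      \<le> ennreal (2 powr q) * epow (\<integral>\<^sup>+x. ennreal (layer_const p) * epow (g x) p \<partial>M) (q / p)"
    unfolding layer_const_def using pos K p
    by (intro mult_left_mono epow_mono nn_integral_mono layer_sum_le) auto
  also have "\<dots> = ennreal (2 powr q * layer_const p powr (q / p)) * epow (\<integral>\<^sup>+x. epow (g x) p \<partial>M) (q / p)"
    using pos layer_const_pos[OF p(1)]
    by (simp add: nn_integral_cmult epow_mult epow_ennreal ennreal_mult mult.assoc)
  finally show ?thesis .
qed

text \<open>The pointwise bound \<open>y \<le> 1 + epow y p\<close> takes the place of Hoelder's
  inequality, since only finiteness matters.\<close>

lemma set_integral_finite_of_power: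
  assumes [measurable]: "Q \<in> sets M" "g \<in> borel_measurable M" and p: "1 < p"
    and fin: "emeasure M Q < \<infinity>" "(\<integral>\<^sup>+x. epow (g x) p \<partial>M) < \<infinity>"
  shows "(\<integral>\<^sup>+x\<in>Q. g x \<partial>M) < \<infinity>"
proof -
  have *: "y \<le> 1 + epow y p" for y
  proof (cases y)
    case (real r)
    have "r \<le> 1 + r powr p"
    proof (cases "r \<le> 1")
      case False
      then have "r powr 1 \<le> r powr p" using p by (intro powr_mono) auto
      then show ?thesis using False by simp
    qed (use p in \<open>auto intro: order.trans\<close>)
    then show ?thesis using real by (simp add: epow_ennreal flip: ennreal_1 ennreal_plus)
  qed auto
  have "(\<integral>\<^sup>+x\<in>Q. g x \<partial>M) \<le> (\<integral>\<^sup>+x. indicator Q x + epow (g x) p \<partial>M)"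
    using * by (intro nn_integral_mono) (auto simp: indicator_def)
  also have "\<dots> = emeasure M Q + (\<integral>\<^sup>+x. epow (g x) p \<partial>M)"
    by (subst nn_integral_add) auto
  also have "\<dots> < \<infinity>" using fin by (auto simp: less_top)
  finally show ?thesis .
qed

text \<open>The single level \<open>k\<close> with
  \<open>2 powr k \<le> a \<le> 2 powr (k + 1)\<close> already bounds the power. \<open>K\<close> is
  any finite set containing it, so that one set can serve for many values of
  \<open>a\<close>.\<close>

lemma epow_le_sum_dyadic:
  fixes q :: real and K :: "int set"
  assumes "finite K" "0 < q" "a < \<infinity>" "a \<noteq> 0 \<Longrightarrow> \<lfloor>log 2 (enn2real a)\<rfloor> \<in> K"
  shows "epow a q \<le> (\<Sum>k\<in>K. ennreal (2 powr (q * (real_of_int k + 1))) * of_bool (ennreal (2 powr real_of_int k) \<le> a))"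
proof (cases "a = 0")
  case False
  then obtain r where r: "a = ennreal r" "0 < r"
    using assms(3) by (cases a) (auto simp: order.order_iff_strict)
  define k where "k = \<lfloor>log 2 r\<rfloor>"
  have k: "2 powr k \<le> r" "r \<le> 2 powr (k + 1)"
    using r le_log_iff[of 2 r k] log_le_iff[of 2 r "k + 1"]
    by (auto simp: k_def real_of_int_floor_add_one_ge)
  have "r powr q \<le> (2 powr (k + 1)) powr q"
    using k r assms by (intro powr_mono2) auto
  then have "epow a q \<le> ennreal (2 powr (q * (real_of_int k + 1))) * of_bool (ennreal (2 powr real_of_int k) \<le> a)"
    using r k by (simp add: epow_ennreal powr_powr mult.commute ennreal_leI)
  also have "\<dots> \<le> (\<Sum>k\<in>K. ennreal (2 powr (q * (real_of_int k + 1))) * of_bool (ennreal (2 powr real_of_int k) \<le> a))"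
    using assms(1) assms(4)[OF False] r
    by (intro member_le_sum[of k K "\<lambda>k. ennreal (2 powr (q * (real_of_int k + 1))) * of_bool (ennreal (2 powr real_of_int k) \<le> a)"]) (auto simp: k_def)
  finally show ?thesis .
qed simp

text \<open>The hypothesis \<open>test\<close> is a packing condition of Carleson type. Each
  exponent \<open>q / p i\<close> is at least 1, so after the passage to disjoint cubes the indices
  can be treated one at a time.\<close>

lemma multilinear_carleson_embedding:
  fixes lam :: "'a set \<Rightarrow> ennreal" and \<mu> :: "'i \<Rightarrow> 'a measure"
  assumes I: "finite I" "I \<noteq> {}" and F: "finite F"
    and laminar: "\<And>Q R. Q \<in> F \<Longrightarrow> R \<in> F \<Longrightarrow> Q \<inter> R = {} \<or> Q \<subseteq> R \<or> R \<subseteq> Q"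
    and sets: "\<And>i. i \<in> I \<Longrightarrow> F \<subseteq> sets (\<mu> i)"
    and fin: "\<And>i Q. i \<in> I \<Longrightarrow> Q \<in> F \<Longrightarrow> emeasure (\<mu> i) Q < \<infinity>"
    and p: "\<And>i. i \<in> I \<Longrightarrow> 1 < p i" "\<And>i. i \<in> I \<Longrightarrow> p i \<le> q"
    and g: "\<And>i. i \<in> I \<Longrightarrow> g i \<in> borel_measurable (\<mu> i)"
      "\<And>i. i \<in> I \<Longrightarrow> (\<integral>\<^sup>+x. epow (g i x) (p i) \<partial>\<mu> i) < \<infinity>"
    and test: "\<And>R. R \<in> F \<Longrightarrow>
      (\<Sum>Q\<in>{Q\<in>F. Q \<subseteq> R}. lam Q) \<le> A * (\<Prod>i\<in>I. epow (emeasure (\<mu> i) R) (q / p i))"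
  shows "(\<Sum>Q\<in>F. lam Q * (\<Prod>i\<in>I. epow ((\<integral>\<^sup>+x\<in>Q. g i x \<partial>\<mu> i) / emeasure (\<mu> i) Q) q))
    \<le> A * (\<Prod>i\<in>I. ennreal (2 powr q * layer_const (p i) powr (q / p i)) *
             epow (\<integral>\<^sup>+x. epow (g i x) (p i) \<partial>\<mu> i) (q / p i))"
proof -
  define a where "a i Q = (\<integral>\<^sup>+x\<in>Q. g i x \<partial>\<mu> i) / emeasure (\<mu> i) Q" for i Q
  \<comment> \<open>One finite set of levels for all indices and cubes; the layers are then indexed
    by functions from \<open>I\<close> to \<open>K\<close>.\<close>
  define K where "K = (\<lambda>(i, Q). \<lfloor>log 2 (enn2real (a i Q))\<rfloor>) ` (I \<times> F)"
  define c where "c k = ennreal (2 powr (q * (real_of_int k + 1)))" for k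
  define \<tau> where "\<tau> i k = ennreal (2 / 2 powr real_of_int k) *
        (\<integral>\<^sup>+x. g i x * indicator {y. ennreal (2 powr k / 2) < y} (g i x) \<partial>\<mu> i)" for i k
  define G where "G \<kappa> = {Q \<in> F. \<forall>i\<in>I. ennreal (2 powr real_of_int (\<kappa> i)) \<le> a i Q}" for \<kappa>
  have K: "finite K" using I F by (auto simp: K_def)
  have q: "0 < q" using I(2) p by force
  \<comment> \<open>On a null set the average is \<open>0 / 0\<close>, which is 0 in
    \<open>ennreal\<close>; this keeps \<open>a i Q\<close> finite.\<close>
  have int0: "(\<integral>\<^sup>+x\<in>Q. g i x \<partial>\<mu> i) = 0" if "i \<in> I" "Q \<in> F" "emeasure (\<mu> i) Q = 0" for i Q
  proof -
    have "AE x in \<mu> i. x \<notin> Q" using that sets[of i] by (intro AE_not_in) auto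
    then have "(\<integral>\<^sup>+x\<in>Q. g i x \<partial>\<mu> i) = (\<integral>\<^sup>+x. 0 \<partial>\<mu> i)"
      by (intro nn_integral_cong_AE) (auto simp: indicator_def)
    then show ?thesis by simp
  qed
  have a_fin: "a i Q < \<infinity>" if "i \<in> I" "Q \<in> F" for i Q
  proof -
    have "(\<integral>\<^sup>+x\<in>Q. g i x \<partial>\<mu> i) < \<infinity>"
      using that sets[of i] p fin g by (intro set_integral_finite_of_power) auto
    then show ?thesis using int0[OF that]
      by (cases "emeasure (\<mu> i) Q = 0") (auto simp: a_def less_top[symmetric] ennreal_divide_eq_top_iff)
  qed
  have layer: "(\<Sum>Q\<in>G \<kappa>. lam Q) \<le> A * (\<Prod>i\<in>I. epow (\<tau> i (\<kappa> i)) (q / p i))" for \<kappa>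
  proof -
    obtain H where H: "H \<subseteq> G \<kappa>" "disjoint H"
      "(\<Sum>Q\<in>G \<kappa>. lam Q) \<le> (\<Sum>R\<in>H. A * (\<Prod>i\<in>I. epow (emeasure (\<mu> i) R) (q / p i)))"
    proof (rule sum_le_sum_maximal[of "G \<kappa>" lam "\<lambda>R. A * (\<Prod>i\<in>I. epow (emeasure (\<mu> i) R) (q / p i))"])
      fix R assume R: "R \<in> G \<kappa>"
      have "(\<Sum>Q\<in>{Q\<in>G \<kappa>. Q \<subseteq> R}. lam Q) \<le> (\<Sum>Q\<in>{Q\<in>F. Q \<subseteq> R}. lam Q)"
        using F by (intro sum_mono2) (auto simp: G_def)
      also have "\<dots> \<le> A * (\<Prod>i\<in>I. epow (emeasure (\<mu> i) R) (q / p i))"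
        using R by (intro test) (auto simp: G_def)
      finally show "(\<Sum>Q\<in>{Q\<in>G \<kappa>. Q \<subseteq> R}. lam Q) \<le> A * (\<Prod>i\<in>I. epow (emeasure (\<mu> i) R) (q / p i))" .
    next
      fix Q R assume "Q \<in> G \<kappa>" "R \<in> G \<kappa>"
      then show "Q \<inter> R = {} \<or> Q \<subseteq> R \<or> R \<subseteq> Q" by (intro laminar) (auto simp: G_def)
    qed (use F in \<open>auto simp: G_def\<close>)
    have HF: "H \<subseteq> F" using H(1) by (auto simp: G_def)
    then have "finite H" using F finite_subset by blast
    have "(\<Sum>Q\<in>G \<kappa>. lam Q) \<le> A * (\<Sum>R\<in>H. \<Prod>i\<in>I. epow (emeasure (\<mu> i) R) (q / p i))"
      using H(3) by (simp add: sum_distrib_left)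
    \<comment> \<open>This decouples the indices: the remaining task is a one-function weak-type
      bound over the disjoint family \<open>H\<close>.\<close>
    also have "\<dots> \<le> A * (\<Prod>i\<in>I. \<Sum>R\<in>H. epow (emeasure (\<mu> i) R) (q / p i))"
      using I \<open>finite H\<close> by (intro mult_left_mono sum_prod_le_prod_sum) auto
    also have "\<dots> \<le> A * (\<Prod>i\<in>I. epow (\<tau> i (\<kappa> i)) (q / p i))"
    proof (intro mult_left_mono prod_mono_ennreal)
      fix i assume i: "i \<in> I"
      have r: "1 \<le> q / p i" using p[OF i] by auto
      have "(\<Sum>R\<in>H. emeasure (\<mu> i) R) \<le> \<tau> i (\<kappa> i)"
        unfolding \<tau>_def
      proof (rule sum_emeasure_le_truncated)
        fix Q assume "Q \<in> H"
        then have Q: "Q \<in> F" "ennreal (2 powr real_of_int (\<kappa> i)) \<le> a i Q"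
          using H(1) i by (auto simp: G_def)
        have "ennreal (2 powr real_of_int (\<kappa> i)) * emeasure (\<mu> i) Q \<le> a i Q * emeasure (\<mu> i) Q"
          using Q by (intro mult_right_mono) auto
        also have "\<dots> \<le> (\<integral>\<^sup>+x\<in>Q. g i x \<partial>\<mu> i)"
          using fin[OF i Q(1)] int0[OF i Q(1)]
          by (cases "emeasure (\<mu> i) Q = 0")
             (auto simp: a_def ennreal_divide_times ennreal_times_divide less_top
                ennreal_mult_divide_eq)
        finally show "ennreal (2 powr real_of_int (\<kappa> i)) * emeasure (\<mu> i) Q \<le> (\<integral>\<^sup>+x\<in>Q. g i x \<partial>\<mu> i)" .
      qed (use \<open>finite H\<close> H HF sets[OF i] fin[OF i] g i in auto)
      then have "epow (\<Sum>R\<in>H. emeasure (\<mu> i) R) (q / p i) \<le> epow (\<tau> i (\<kappa> i)) (q / p i)"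
        using r by (intro epow_mono) auto
      with epow_sum_le[OF r] show "(\<Sum>R\<in>H. epow (emeasure (\<mu> i) R) (q / p i)) \<le> epow (\<tau> i (\<kappa> i)) (q / p i)"
        by (rule order.trans)
    qed auto
    finally show ?thesis .
  qed
  have "(\<Sum>Q\<in>F. lam Q * (\<Prod>i\<in>I. epow (a i Q) q))
    \<le> (\<Sum>Q\<in>F. lam Q * (\<Prod>i\<in>I. \<Sum>k\<in>K. c k * of_bool (ennreal (2 powr real_of_int k) \<le> a i Q)))"
    using K q a_fin unfolding c_def
    by (intro sum_mono mult_left_mono prod_mono_ennreal epow_le_sum_dyadic) (auto simp: K_def)
  \<comment> \<open>The product of sums expands over all level functions \<kappa>. The product of
    the threshold conditions says exactly that \<open>Q\<close> lies in
    \<open>G \<kappa>\<close>.\<close>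
  also have "\<dots> = (\<Sum>Q\<in>F. \<Sum>\<kappa>\<in>PiE I (\<lambda>_. K). (\<Prod>i\<in>I. c (\<kappa> i)) * (lam Q * of_bool (Q \<in> G \<kappa>)))"
  proof (rule sum.cong)
    fix Q assume "Q \<in> F"
    have "(\<Prod>i\<in>I. of_bool (P i)) = (of_bool (\<forall>i\<in>I. P i) :: ennreal)" for P
      using I(1) by (induction rule: finite_induct) auto
    then show "lam Q * (\<Prod>i\<in>I. \<Sum>k\<in>K. c k * of_bool (ennreal (2 powr real_of_int k) \<le> a i Q))
      = (\<Sum>\<kappa>\<in>PiE I (\<lambda>_. K). (\<Prod>i\<in>I. c (\<kappa> i)) * (lam Q * of_bool (Q \<in> G \<kappa>)))"
      using I K \<open>Q \<in> F\<close>
      by (subst prod_sum_PiE) (auto simp: prod.distrib sum_distrib_left G_def mult_ac)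
  qed simp
  also have "\<dots> = (\<Sum>\<kappa>\<in>PiE I (\<lambda>_. K). (\<Prod>i\<in>I. c (\<kappa> i)) * (\<Sum>Q\<in>G \<kappa>. lam Q))"
  proof (subst sum.swap, rule sum.cong)
    fix \<kappa>
    have "(\<Sum>Q\<in>F. lam Q * of_bool (Q \<in> G \<kappa>)) = (\<Sum>Q\<in>G \<kappa>. lam Q)"
      using F by (intro sum.mono_neutral_cong_right) (auto simp: G_def)
    then show "(\<Sum>Q\<in>F. (\<Prod>i\<in>I. c (\<kappa> i)) * (lam Q * of_bool (Q \<in> G \<kappa>))) =
        (\<Prod>i\<in>I. c (\<kappa> i)) * (\<Sum>Q\<in>G \<kappa>. lam Q)"
      by (simp only: flip: sum_distrib_left)
  qed simp
  also have "\<dots> \<le> (\<Sum>\<kappa>\<in>PiE I (\<lambda>_. K). (\<Prod>i\<in>I. c (\<kappa> i)) * (A * (\<Prod>i\<in>I. epow (\<tau> i (\<kappa> i)) (q / p i))))"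
    by (intro sum_mono mult_left_mono layer) auto
  also have "\<dots> = A * (\<Sum>\<kappa>\<in>PiE I (\<lambda>_. K). \<Prod>i\<in>I. c (\<kappa> i) * epow (\<tau> i (\<kappa> i)) (q / p i))"
    by (simp add: prod.distrib sum_distrib_left mult_ac)
  \<comment> \<open>The layer bound is a product of terms depending on a single
    \<open>\<kappa> i\<close>, so the expansion can be undone.\<close>
  also have "\<dots> = A * (\<Prod>i\<in>I. \<Sum>k\<in>K. c k * epow (\<tau> i k) (q / p i))"
    using I K by (subst prod_sum_PiE) auto
  also have "\<dots> \<le> A * (\<Prod>i\<in>I. ennreal (2 powr q * layer_const (p i) powr (q / p i)) *
             epow (\<integral>\<^sup>+x. epow (g i x) (p i) \<partial>\<mu> i) (q / p i))"
    unfolding c_def \<tau>_def using K p g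
    by (intro mult_left_mono prod_mono_ennreal truncated_sum_le) auto
  finally show ?thesis unfolding a_def .
qed

subsection \<open>Shifted dyadic grids\<close>

text \<open>
  The grid is shifted by \<open>(-2) ^ k / 3\<close> at level \<open>k\<close> in the coordinates in \<open>E\<close>: this is plus or minus a third
  of the side length, and the grids stay nested since \<open>(-2) ^ d\<close> is 1 modulo 3. Cubes are half-open, given as
  the classes of points with equal \<open>cell\<close> in every coordinate.
\<close>

definition cell :: "bool \<Rightarrow> int \<Rightarrow> real \<Rightarrow> int" where
  "cell e k t = \<lfloor>(t - of_bool e * ((-2) powi k / 3)) / 2 powi k\<rfloor>"

definition dyadic :: "'a::euclidean_space set \<Rightarrow> int \<Rightarrow> 'a \<Rightarrow> 'a set" where
  "dyadic E k x = {y. \<forall>b\<in>Basis. cell (b \<in> E) k (y \<bullet> b) = cell (b \<in> E) k (x \<bullet> b)}"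

lemma cell_mono: "s \<le> t \<Longrightarrow> cell e k s \<le> cell e k t"
  unfolding cell_def by (intro floor_mono divide_right_mono) auto

lemma neg2_power_mod_3: "\<exists>c::int. (-2) ^ d = 3 * c + 1"
proof (induction d)
  case (Suc d)
  then obtain c where "(-2) ^ d = 3 * c + (1::int)" by blast
  then have "(-2) ^ Suc d = 3 * (- 2 * c - 1) + (1::int)" by simp
  then show ?case by blast
qed (auto intro: exI[of _ 0])

text \<open>The index at the coarse level depends only on the index at the fine level, which is the
  nesting of the grids. Since \<open>(-2) ^ d - 1\<close> is a multiple of 3, the shifts at the two
  levels differ by an integer multiple of \<open>2 powi k\<close>, and the floor of a quotient by
  \<open>2 ^ d\<close> only sees the floor of the numerator.\<close>

lemma cell_parent:
  assumes "k \<le> l"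
  shows "\<exists>c d. \<forall>t. cell e l t = (cell e k t - c) div 2 ^ d"
proof -
  define d where "d = nat (l - k)"
  have l: "l = k + int d" using assms by (simp add: d_def)
  obtain c :: int where c: "(-2) ^ d = 3 * c + 1" using neg2_power_mod_3 by blast
  have "real_of_int ((-2) ^ d) = real_of_int (3 * c + 1)" using c by (simp only:)
  then have c': "(-2) ^ d = 3 * real_of_int c + 1" by simp
  define s :: int where "s = (if even k then 1 else - 1)"
  have s: "(-2) powi k = real_of_int s * 2 powi k"
    by (auto simp: s_def power_int_minus_left)
  have "cell e l t = (cell e k t - of_bool e * s * c) div 2 ^ d" for t
  proof -
    have "(t - of_bool e * ((-2) powi l / 3)) / 2 powi l
       = ((t - of_bool e * ((-2) powi k / 3)) / 2 powi k - of_bool e * s * c) / 2 ^ d"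
    proof -
      have "(-2) powi l = real_of_int s * 2 powi k * (3 * real_of_int c + 1)"
        unfolding l by (simp add: power_int_add c' s)
      moreover have "2 powi l = 2 powi k * (2::real) ^ d"
        unfolding l by (simp add: power_int_add)
      ultimately show ?thesis by (simp add: s field_simps)
    qed
    also have "\<dots> = ((t - of_bool e * ((-2) powi k / 3)) / 2 powi k - real_of_int (of_bool e * s * c)) / real_of_int (2 ^ d)"
      by simp
    finally show ?thesis
      unfolding cell_def by (simp only: floor_divide_real_eq_div zero_le_power zero_le_numeral floor_diff_of_int)
  qed
  then show ?thesis by blast
qed

lemma dyadic_refl: "x \<in> dyadic E k x"
  by (simp add: dyadic_def)

lemma dyadic_eq: "y \<in> dyadic E k x \<Longrightarrow> dyadic E k y = dyadic E k x"
  by (simp add: dyadic_def)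

lemma dyadic_subset_coarser: "k \<le> l \<Longrightarrow> dyadic E k x \<subseteq> dyadic E l x"
proof
  fix y assume kl: "k \<le> l" and y: "y \<in> dyadic E k x"
  show "y \<in> dyadic E l x"
    unfolding dyadic_def
  proof (intro CollectI ballI)
    fix b :: 'a assume "b \<in> Basis"
    then have "cell (b \<in> E) k (y \<bullet> b) = cell (b \<in> E) k (x \<bullet> b)"
      using y by (simp add: dyadic_def)
    then show "cell (b \<in> E) l (y \<bullet> b) = cell (b \<in> E) l (x \<bullet> b)"
      using cell_parent[OF kl, of "b \<in> E"] by auto
  qed
qed

text \<open>Two classes with a common point \<open>z\<close> are both classes of \<open>z\<close>,
  and the classes of one point are nested by level.\<close>

lemma dyadic_laminar:
  "dyadic E k x \<inter> dyadic E l y = {} \<or> dyadic E k x \<subseteq> dyadic E l y \<or> dyadic E l y \<subseteq> dyadic E k x"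
proof (cases "dyadic E k x \<inter> dyadic E l y = {}")
  case False
  then obtain z where z: "z \<in> dyadic E k x" "z \<in> dyadic E l y" by blast
  have "dyadic E k z \<subseteq> dyadic E l z \<or> dyadic E l z \<subseteq> dyadic E k z"
    using dyadic_subset_coarser[of k l E z] dyadic_subset_coarser[of l k E z] by (cases "k \<le> l") auto
  then show ?thesis using z by (simp add: dyadic_eq)
qed simp

lemma dyadic_explicit:
  fixes x :: "'a::euclidean_space"
  obtains a where "dyadic E k x = {y. \<forall>b\<in>Basis. a \<bullet> b \<le> y \<bullet> b \<and> y \<bullet> b < a \<bullet> b + 2 powi k}"
proof
  define a :: 'a where "a = (\<Sum>b\<in>Basis. (2 powi k * real_of_int (cell (b \<in> E) k (x \<bullet> b))
      + of_bool (b \<in> E) * ((-2) powi k / 3)) *\<^sub>R b)"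
  have "cell e k t = c \<longleftrightarrow> 2 powi k * real_of_int c + of_bool e * ((-2) powi k / 3) \<le> t
      \<and> t < 2 powi k * real_of_int c + of_bool e * ((-2) powi k / 3) + 2 powi k" for e t c
  proof -
    have "(0::real) < 2 powi k" by simp
    then show ?thesis
      unfolding cell_def floor_eq_iff by (auto simp: field_simps)
  qed
  then show "dyadic E k x = {y. \<forall>b\<in>Basis. a \<bullet> b \<le> y \<bullet> b \<and> y \<bullet> b < a \<bullet> b + 2 powi k}"
    by (simp add: dyadic_def a_def)
qed

lemma measure_cube:
  "0 \<le> h \<Longrightarrow> measure lborel (cbox a (a + h *\<^sub>R One :: 'a::euclidean_space)) = h ^ DIM('a)"
  by (subst measure_lborel_cbox) (auto simp: inner_add_left)

lemma dyadic_measurable [measurable]: "dyadic E k x \<in> sets borel"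
proof -
  obtain a where "dyadic E k x = {y. \<forall>b\<in>Basis. a \<bullet> b \<le> y \<bullet> b \<and> y \<bullet> b < a \<bullet> b + 2 powi k}"
    by (rule dyadic_explicit)
  also have "\<dots> \<in> sets borel" by measurable
  finally show ?thesis .
qed

text \<open>The operator and the testing condition speak of closed cubes. A grid cube is exchanged
  for its closure, which adds only a null set.\<close>

lemma dyadic_closed_cube:
  fixes x :: "'a::euclidean_space"
  obtains C where "cube C" "dyadic E k x \<subseteq> C" "C - dyadic E k x \<in> null_sets lborel"
    "measure lborel C = (2 powi k) ^ DIM('a)"
proof -
  obtain a where a: "dyadic E k x = {y. \<forall>b\<in>Basis. a \<bullet> b \<le> y \<bullet> b \<and> y \<bullet> b < a \<bullet> b + 2 powi k}"
    by (rule dyadic_explicit)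
  let ?C = "cbox a (a + (2 powi k) *\<^sub>R One)" and ?B = "box a (a + (2 powi k) *\<^sub>R One)"
  have "?B \<subseteq> dyadic E k x" "dyadic E k x \<subseteq> ?C"
    unfolding a by (auto simp: mem_box inner_add_left less_imp_le)
  moreover from this have "?C - dyadic E k x \<in> null_sets lborel"
    by (intro null_sets_subset[OF null_sets_cbox_Diff_box[of a "a + (2 powi k) *\<^sub>R One"]]) auto
  moreover have "cube ?C" unfolding cube_def
    by (intro exI[of _ a] exI[of _ "2 powi k"]) auto
  ultimately show ?thesis
    by (intro that[of ?C]) (auto simp: measure_cube)
qed

lemma emeasure_diff_null_eq:
  assumes "A \<subseteq> C" "C - A \<in> null_sets M" "A \<in> sets M"
  shows "emeasure M C = emeasure M A"
proof -
  have "A \<union> (C - A) = C" using assms by auto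
  with emeasure_Un_null_set[OF assms(3,2)] show ?thesis by simp
qed

lemma measure_dyadic: "measure lborel (dyadic E k x :: 'a::euclidean_space set) = (2 powi k) ^ DIM('a)"
proof -
  obtain C where C: "cube C" "dyadic E k x \<subseteq> C" "C - dyadic E k x \<in> null_sets lborel"
    "measure lborel C = (2 powi k) ^ DIM('a)" by (rule dyadic_closed_cube)
  then have "emeasure lborel C = emeasure lborel (dyadic E k x)"
    by (intro emeasure_diff_null_eq) auto
  then show ?thesis using C(4) by (simp add: measure_def)
qed

text \<open>A grid cube is determined by its level and one integer for each coordinate.\<close>

lemma countable_dyadic: "countable (range (\<lambda>(k, x :: 'a::euclidean_space). dyadic E k x))"
proof (rule countable_subset)
  define J where "J = (PiE Basis (\<lambda>_. UNIV) :: ('a \<Rightarrow> int) set)"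
  show "range (\<lambda>(k, x). dyadic E k x) \<subseteq>
      (\<lambda>(k, j). {y. \<forall>b\<in>Basis. cell (b \<in> E) k (y \<bullet> b) = j b}) ` (UNIV \<times> J)"
  proof (clarify)
    fix k and x :: 'a
    have "dyadic E k x = {y. \<forall>b\<in>Basis. cell (b \<in> E) k (y \<bullet> b) = restrict (\<lambda>b. cell (b \<in> E) k (x \<bullet> b)) Basis b}"
      by (simp add: dyadic_def)
    then show "dyadic E k x \<in> (\<lambda>(k, j). {y. \<forall>b\<in>Basis. cell (b \<in> E) k (y \<bullet> b) = j b}) ` (UNIV \<times> J)"
      by (auto simp: J_def intro!: image_eqI[of _ _ "(k, restrict (\<lambda>b. cell (b \<in> E) k (x \<bullet> b)) Basis)"])
  qed
  show "countable ((\<lambda>(k, j). {y. \<forall>b\<in>Basis. cell (b \<in> E) k (y \<bullet> b) = j b}) ` (UNIV \<times> J))"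
    unfolding J_def by (intro countable_image countable_SIGMA countable_PiE) auto
qed

text \<open>If both grids separated \<open>u\<close> from \<open>u + h\<close>, then, in units of
  the side length, an integer \<open>N\<close> and a shifted integer \<open>N' + s\<close> would lie
  in a half-open interval of length below 1/3. But \<open>s\<close> is 1/3 or -1/3, at distance at
  least 1/3 from every integer.\<close>

lemma cell_one_third:
  assumes "3 * h < 2 powi k" "0 < h"
  shows "\<exists>e. cell e k u = cell e k (u + h)"
proof (rule ccontr)
  assume "\<not> ?thesis"
  then have ne: "cell False k u < cell False k (u + h)" "cell True k u < cell True k (u + h)"
    using cell_mono[of u "u + h" _ k] assms by (auto simp: order.order_iff_strict)
  define z where "z = u / 2 powi k"
  define \<delta> where "\<delta> = h / 2 powi k"
  define s :: real where "s = (if even k then 1 / 3 else - 1 / 3)"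
  have pos: "(0::real) < 2 powi k" by simp
  have \<delta>: "\<delta> < 1 / 3" using assms pos by (simp add: \<delta>_def field_simps)
  have c: "cell False k u = \<lfloor>z\<rfloor>" "cell False k (u + h) = \<lfloor>z + \<delta>\<rfloor>"
    "cell True k u = \<lfloor>z - s\<rfloor>" "cell True k (u + h) = \<lfloor>z - s + \<delta>\<rfloor>"
    by (auto simp: cell_def z_def \<delta>_def s_def power_int_minus_left field_simps)
  define N where "N = \<lfloor>z + \<delta>\<rfloor>"
  define N' where "N' = \<lfloor>z - s + \<delta>\<rfloor>"
  have "z < N" "N \<le> z + \<delta>" "z - s < N'" "N' \<le> z - s + \<delta>"
    using ne unfolding c N_def N'_def by linarith+
  then have "\<bar>real_of_int (N - N') - s\<bar> < 1 / 3" using \<delta> by (auto simp: abs_if)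
  moreover have "real_of_int (N - N') \<le> - 1 \<or> real_of_int (N - N') = 0 \<or> 1 \<le> real_of_int (N - N')"
  proof -
    have "N - N' \<le> - 1 \<or> N - N' = 0 \<or> 1 \<le> N - N'" by arith
    then show ?thesis by (metis of_int_le_iff of_int_minus of_int_1 of_int_0)
  qed
  moreover have "s = 1 / 3 \<or> s = - 1 / 3" by (simp add: s_def)
  ultimately show False by (auto simp: abs_if split: if_splits)
qed

text \<open>The one-third trick, applied in each coordinate independently. The set \<open>E\<close>
  of shifted coordinates takes finitely many values, so finitely many grids suffice for all
  cubes.\<close>

lemma cube_subset_dyadic:
  fixes Q :: "'a::euclidean_space set"
  assumes "cube Q"
  obtains E k where "E \<subseteq> Basis" "\<And>x. x \<in> Q \<Longrightarrow> Q \<subseteq> dyadic E k x"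
    "(2 powi k) ^ DIM('a) \<le> 6 ^ DIM('a) * measure lborel Q" "0 < measure lborel Q"
proof -
  obtain a h where h: "0 < h" and Q: "Q = cbox a (a + h *\<^sub>R One)"
    using assms by (auto simp: cube_def)
  \<comment> \<open>The choice gives \<open>2 powi (k - 1) \<le> 3 * h < 2 powi k\<close>: the right
    half is the hypothesis of \<open>cell_one_third\<close>, the left half gives the ratio 6 of the
    side lengths.\<close>
  define k where "k = \<lfloor>log 2 (3 * h)\<rfloor> + 1"
  have "2 powr (k - 1) \<le> 3 * h" "3 * h < 2 powr k"
    using h by (auto simp: k_def le_log_iff[symmetric] log_less_iff[symmetric])
  then have k: "2 powi k \<le> 6 * h" "3 * h < 2 powi k"
    by (auto simp: powr_real_of_int' powr_diff)
  \<comment> \<open>Shift the coordinates in which the shifted grid keeps both endpoints in one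
    cell; in the others \<open>cell_one_third\<close> leaves the unshifted grid.\<close>
  define E where "E = {b \<in> Basis. cell True k (a \<bullet> b) = cell True k (a \<bullet> b + h)}"
  have E: "cell (b \<in> E) k (a \<bullet> b) = cell (b \<in> E) k (a \<bullet> b + h)" if "b \<in> Basis" for b
  proof -
    obtain e where "cell e k (a \<bullet> b) = cell e k (a \<bullet> b + h)"
      using cell_one_third[OF k(2) h] by blast
    then show ?thesis using that by (cases e; cases "b \<in> E") (auto simp: E_def)
  qed
  have sub: "Q \<subseteq> dyadic E k x" if "x \<in> Q" for x
  proof -
    have "cell (b \<in> E) k (y \<bullet> b) = cell (b \<in> E) k (a \<bullet> b)" if "b \<in> Basis" "y \<in> Q" for y b
    proof -
      have "a \<bullet> b \<le> y \<bullet> b" "y \<bullet> b \<le> a \<bullet> b + h"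
        using that by (auto simp: Q mem_box inner_add_left)
      then show ?thesis using cell_mono[of "a \<bullet> b" "y \<bullet> b" "b \<in> E" k]
          cell_mono[of "y \<bullet> b" "a \<bullet> b + h" "b \<in> E" k] E[OF that(1)] by linarith
    qed
    then show ?thesis using that by (auto simp: dyadic_def)
  qed
  have m: "measure lborel Q = h ^ DIM('a)" using h unfolding Q by (intro measure_cube) auto
  have "(2 powi k) ^ DIM('a) \<le> (6 * h) ^ DIM('a)" using k by (intro power_mono) auto
  then show ?thesis using sub m h
    by (intro that[of E k]) (auto simp: E_def power_mult_distrib)
qed

subsection \<open>The maximal operator on a dyadic grid\<close>

definition frac_avg :: "nat \<Rightarrow> real \<Rightarrow> (nat \<Rightarrow> 'a::euclidean_space \<Rightarrow> ennreal) \<Rightarrow> 'a set \<Rightarrow> ennreal" where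
  "frac_avg m \<alpha> f Q = (\<Prod>i<m. ennreal (measure lborel Q powr (\<alpha> / (real m * real DIM('a)) - 1))
      * (\<integral>\<^sup>+ y\<in>Q. f i y \<partial>lborel))"

lemma Mfrac_eq: "Mfrac m \<alpha> f x = (SUP Q \<in> {Q. cube Q \<and> x \<in> Q}. frac_avg m \<alpha> f Q)"
  by (simp add: Mfrac_def frac_avg_def)

lemma frac_avg_cong:
  assumes "\<And>i. i < m \<Longrightarrow> AE x in lborel. f i x = g i x"
  shows "frac_avg m \<alpha> f Q = frac_avg m \<alpha> g Q"
  unfolding frac_avg_def
proof (intro prod.cong refl arg_cong2[where f = "(*)"])
  fix i assume "i \<in> {..<m}"
  then have "AE x in lborel. f i x = g i x" using assms by simp
  then show "(\<integral>\<^sup>+ y\<in>Q. f i y \<partial>lborel) = (\<integral>\<^sup>+ y\<in>Q. g i y \<partial>lborel)"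
    by (intro nn_integral_cong_AE) auto
qed

text \<open>Enlarging the cube increases the integrals. As \<open>\<alpha> < m * n\<close>, with
  \<open>n\<close> the dimension, the normalizing exponent is negative, and comparable volumes cost
  at most \<open>(6 ^ n) powr \<beta>\<close> in each of the \<open>m\<close> factors.\<close>

lemma frac_avg_cube_le_dyadic:
  fixes Q :: "'a::euclidean_space set"
  assumes m: "1 \<le> m" and \<alpha>: "\<alpha> < real m * real DIM('a)"
    and sub: "Q \<subseteq> dyadic E k x"
    and le: "(2 powi k) ^ DIM('a) \<le> 6 ^ DIM('a) * measure lborel Q" and pos: "0 < measure lborel Q"
  shows "frac_avg m \<alpha> f Q \<le>
    ennreal ((6 ^ DIM('a)) powr (1 - \<alpha> / (real m * real DIM('a)))) ^ m * frac_avg m \<alpha> f (dyadic E k x)"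
proof -
  define \<beta> where "\<beta> = 1 - \<alpha> / (real m * real DIM('a))"
  have \<beta>: "0 < \<beta>" using \<alpha> m by (simp add: \<beta>_def field_simps)
  define D where "D = dyadic E k x"
  have D: "measure lborel D = (2 powi k) ^ DIM('a)" by (simp add: D_def measure_dyadic)
  then have "0 < measure lborel D" by simp
  have "measure lborel D powr \<beta> \<le> (6 ^ DIM('a) * measure lborel Q) powr \<beta>"
    using le \<beta> by (intro powr_mono2) (auto simp: D)
  also have "\<dots> = (6 ^ DIM('a)) powr \<beta> * measure lborel Q powr \<beta>"
    by (simp add: powr_mult)
  finally have "measure lborel Q powr (- \<beta>) \<le> (6 ^ DIM('a)) powr \<beta> * measure lborel D powr (- \<beta>)"
    using pos \<open>0 < measure lborel D\<close> by (simp add: powr_minus field_simps)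
  then have c: "ennreal (measure lborel Q powr (- \<beta>))
      \<le> ennreal ((6 ^ DIM('a)) powr \<beta>) * ennreal (measure lborel D powr (- \<beta>))"
    by (simp add: ennreal_leI flip: ennreal_mult)
  have "frac_avg m \<alpha> f Q = (\<Prod>i<m. ennreal (measure lborel Q powr (- \<beta>)) * (\<integral>\<^sup>+ y\<in>Q. f i y \<partial>lborel))"
    by (simp add: frac_avg_def \<beta>_def)
  also have "\<dots> \<le> (\<Prod>i<m. (ennreal ((6 ^ DIM('a)) powr \<beta>) * ennreal (measure lborel D powr (- \<beta>)))
      * (\<integral>\<^sup>+ y\<in>D. f i y \<partial>lborel))"
    using c sub
    by (intro prod_mono_ennreal mult_mono nn_integral_mono) (auto simp: D_def indicator_def)
  also have "\<dots> = ennreal ((6 ^ DIM('a)) powr \<beta>) ^ m * frac_avg m \<alpha> f D"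
    by (simp add: frac_avg_def \<beta>_def prod.distrib mult.assoc)
  finally show ?thesis by (simp add: D_def \<beta>_def)
qed

definition dyadic_grid :: "'a::euclidean_space set \<Rightarrow> 'a set set" where
  "dyadic_grid E = range (\<lambda>(k, x). dyadic E k x)"

lemma dyadic_gridE:
  assumes "Q \<in> dyadic_grid E"
  obtains k x where "Q = dyadic E k x"
  using assms by (auto simp: dyadic_grid_def)

lemma countable_dyadic_grid: "countable (dyadic_grid E)"
  unfolding dyadic_grid_def by (rule countable_dyadic)

lemma dyadic_grid_sets: "Q \<in> dyadic_grid E \<Longrightarrow> Q \<in> sets borel"
  by (auto elim: dyadic_gridE)

definition domination_const :: "nat \<Rightarrow> nat \<Rightarrow> real \<Rightarrow> real" where
  "domination_const n m \<alpha> = ((6 ^ n) powr (1 - \<alpha> / (real m * real n))) ^ m"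

lemma domination_const_pos: "0 < domination_const n m \<alpha>"
  by (simp add: domination_const_def)

text \<open>The maximum over the shifted grids is replaced by their sum, which passes through the
  integral later.\<close>

lemma epow_Mfrac_le_dyadic:
  fixes x :: "'a::euclidean_space"
  assumes m: "1 \<le> m" and \<alpha>: "\<alpha> < real m * real DIM('a)" and q: "0 < q"
  shows "epow (Mfrac m \<alpha> f x) q \<le> ennreal (domination_const DIM('a) m \<alpha> powr q) *
    (\<Sum>E\<in>Pow Basis. SUP Q\<in>dyadic_grid E. indicator Q x * epow (frac_avg m \<alpha> f Q) q)"
  unfolding Mfrac_eq epow_SUP[OF q]
proof (rule SUP_least)
  fix Q assume "Q \<in> {Q. cube Q \<and> x \<in> Q}"
  then have Q: "cube Q" "x \<in> Q" by auto
  let ?c = "domination_const DIM('a) m \<alpha>"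
  from cube_subset_dyadic[OF Q(1)] obtain E k where E: "E \<subseteq> Basis"
    and sub: "\<And>x. x \<in> Q \<Longrightarrow> Q \<subseteq> dyadic E k x"
    and le: "(2 powi k) ^ DIM('a) \<le> 6 ^ DIM('a) * measure lborel Q" "0 < measure lborel Q"
    by metis
  let ?D = "dyadic E k x"
  have "epow (frac_avg m \<alpha> f Q) q \<le> epow (ennreal ?c * frac_avg m \<alpha> f ?D) q"
    using frac_avg_cube_le_dyadic[OF m \<alpha> sub[OF Q(2)] le] q
    by (intro epow_mono) (auto simp: domination_const_def ennreal_power)
  also have "\<dots> = ennreal (?c powr q) * (indicator ?D x * epow (frac_avg m \<alpha> f ?D) q)"
    using q less_imp_le[OF domination_const_pos] by (simp add: epow_mult epow_ennreal dyadic_refl)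
  also have "\<dots> \<le> ennreal (?c powr q) * (SUP Q\<in>dyadic_grid E. indicator Q x * epow (frac_avg m \<alpha> f Q) q)"
    by (intro mult_left_mono SUP_upper) (auto simp: dyadic_grid_def)
  also have "\<dots> \<le> ennreal (?c powr q) *
      (\<Sum>E\<in>Pow Basis. SUP Q\<in>dyadic_grid E. indicator Q x * epow (frac_avg m \<alpha> f Q) q)"
    using E by (intro mult_left_mono member_le_sum) auto
  finally show "epow (frac_avg m \<alpha> f Q) q \<le> ennreal (?c powr q) *
      (\<Sum>E\<in>Pow Basis. SUP Q\<in>dyadic_grid E. indicator Q x * epow (frac_avg m \<alpha> f Q) q)" .
qed

section \<open>Linearization of a finite maximum, and comparison with the testing data\<close>

lemma sum_indicator_disjoint_le:
  fixes c :: "'b \<Rightarrow> ennreal"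
  assumes "finite F" "disjoint_family_on A F" "\<And>Q. Q \<in> F \<Longrightarrow> x \<in> A Q \<Longrightarrow> c Q \<le> y"
  shows "(\<Sum>Q\<in>F. indicator (A Q) x * c Q) \<le> y"
proof -
  have "(\<Sum>Q\<in>F. indicator (A Q) x * c Q) \<le> (\<Sum>Q\<in>F. indicator (A Q) x * y)"
    using assms(3) by (intro sum_mono) (auto simp: indicator_def)
  also have "\<dots> = indicator (\<Union>(A ` F)) x * y"
    using assms by (simp add: indicator_UN_disjoint sum_distrib_right)
  also have "\<dots> \<le> y" by (auto simp: indicator_def)
  finally show ?thesis .
qed

text \<open>Adding one set at a time keeps the selection disjoint and measurable. At each point at
  most one term of the final sum is nonzero, and it is the maximal value there.\<close>

lemma linearize_maximum:
  fixes c :: "'a set \<Rightarrow> ennreal"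
  assumes "finite F" "F \<subseteq> sets M"
  shows "\<exists>A. (\<forall>Q\<in>F. A Q \<in> sets M \<and> A Q \<subseteq> Q) \<and> disjoint_family_on A F \<and>
    (\<forall>x. \<forall>Q\<in>F. indicator Q x * c Q \<le> (\<Sum>R\<in>F. indicator (A R) x * c R))"
  using assms
proof (induction F rule: finite_induct)
  case (insert P F)
  then obtain A where A: "\<And>Q. Q \<in> F \<Longrightarrow> A Q \<in> sets M" "\<And>Q. Q \<in> F \<Longrightarrow> A Q \<subseteq> Q"
    "disjoint_family_on A F"
    "\<And>x Q. Q \<in> F \<Longrightarrow> indicator Q x * c Q \<le> (\<Sum>R\<in>F. indicator (A R) x * c R)"
    by (metis insert_subset)
  define h where "h x = (\<Sum>R\<in>F. indicator (A R) x * c R)" for x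
  have h [measurable]: "h \<in> borel_measurable M"
    unfolding h_def using A(1) by measurable
  \<comment> \<open>The new set \<open>P\<close> takes over where its value strictly exceeds the
    current maximum \<open>h\<close>; elsewhere on \<open>P\<close> the old selection already
    dominates \<open>c P\<close>.\<close>
  define N where "N = {x \<in> space M. h x < c P} \<inter> P"
  have P [measurable]: "P \<in> sets M" using insert.prems by auto
  have N: "N \<in> sets M" "N \<subseteq> P" unfolding N_def by auto
  define A' where "A' Q = (if Q = P then N else A Q - N)" for Q
  have sum_A': "(\<Sum>R\<in>insert P F. indicator (A' R) x * c R) = (if x \<in> N then c P else h x)" for x
  proof -
    have "(\<Sum>R\<in>insert P F. indicator (A' R) x * c R)
        = indicator N x * c P + (\<Sum>R\<in>F. indicator (A R - N) x * c R)"
    proof -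
      have "(\<Sum>R\<in>insert P F. indicator (A' R) x * c R)
          = indicator (A' P) x * c P + (\<Sum>R\<in>F. indicator (A' R) x * c R)"
        using insert.hyps by (intro sum.insert)
      moreover have "(\<Sum>R\<in>F. indicator (A' R) x * c R) = (\<Sum>R\<in>F. indicator (A R - N) x * c R)"
        using insert.hyps by (intro sum.cong) (auto simp: A'_def)
      moreover have "A' P = N" by (simp add: A'_def)
      ultimately show ?thesis by (simp only:)
    qed
    moreover have "(\<Sum>R\<in>F. indicator (A R - N) x * c R) = (if x \<in> N then 0 else h x)"
      unfolding h_def by (auto simp: indicator_def)
    ultimately show ?thesis by auto
  qed
  show ?case
  proof (intro exI[of _ A'] conjI ballI allI)
    show "disjoint_family_on A' (insert P F)"
      using A(3) unfolding disjoint_family_on_def A'_def by auto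
  next
    fix x Q assume Q: "Q \<in> insert P F"
    have *: "h x < c P" if "x \<in> N" using that by (simp add: N_def)
    have **: "c P \<le> h x" if "x \<in> P" "x \<notin> N"
      using that sets.sets_into_space[OF P] by (auto simp: N_def)
    show "indicator Q x * c Q \<le> (\<Sum>R\<in>insert P F. indicator (A' R) x * c R)"
    proof (cases "Q = P")
      case True
      then show ?thesis unfolding sum_A' using ** by (auto simp: indicator_def)
    next
      case False
      then have "indicator Q x * c Q \<le> h x" using A(4)[of Q x] Q by (auto simp: h_def)
      then show ?thesis unfolding sum_A' using * by auto
    qed
  qed (use A N in \<open>auto simp: A'_def\<close>)
qed (auto simp: disjoint_family_on_def)

text \<open>The closure of the grid cube is admissible in the supremum, has the same volume, and
  meets \<open>C\<close> in a set containing the grid cube.\<close>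

lemma frac_avg_dyadic_le_Mfrac:
  assumes "x \<in> dyadic E k y" "dyadic E k y \<subseteq> C"
  shows "frac_avg m \<alpha> \<sigma> (dyadic E k y) \<le> Mfrac m \<alpha> (\<lambda>i y. \<sigma> i y * indicator C y) x"
proof -
  obtain C' where C': "cube C'" "dyadic E k y \<subseteq> C'" "measure lborel C' = (2 powi k) ^ DIM('a)"
    using dyadic_closed_cube by metis
  have "frac_avg m \<alpha> \<sigma> (dyadic E k y) \<le> frac_avg m \<alpha> (\<lambda>i y. \<sigma> i y * indicator C y) C'"
    unfolding frac_avg_def measure_dyadic C'(3) using C'(2) assms(2)
    by (intro prod_mono_ennreal mult_left_mono nn_integral_mono) (auto simp: indicator_def)
  also have "\<dots> \<le> Mfrac m \<alpha> (\<lambda>i y. \<sigma> i y * indicator C y) x"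
    unfolding Mfrac_eq using C' assms(1) by (intro SUP_upper) auto
  finally show ?thesis .
qed

lemma ennreal_eq_mult_divide: "y \<noteq> 0 \<Longrightarrow> y < top \<Longrightarrow> x = y * (x / y :: ennreal)"
  by (simp add: ennreal_times_divide mult.commute[of y] ennreal_mult_divide_eq less_top[symmetric])

definition embedding_const :: "nat \<Rightarrow> (nat \<Rightarrow> real) \<Rightarrow> real \<Rightarrow> real" where
  "embedding_const m p q = (\<Prod>i<m. 2 powr q * layer_const (p i) powr (q / p i))"

lemma embedding_const_pos:
  assumes "\<And>i. i < m \<Longrightarrow> 1 < p i"
  shows "0 < embedding_const m p q"
  unfolding embedding_const_def
proof (intro prod_pos mult_pos_pos)
  fix i assume "i \<in> {..<m}"
  then have "0 < layer_const (p i)" using assms by (intro layer_const_pos) auto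
  then show "0 < layer_const (p i) powr (q / p i)" by simp
qed simp

section \<open>From the testing condition to the norm inequality\<close>

context
  fixes m :: nat and \<alpha> q :: real and p :: "nat \<Rightarrow> real"
    and \<sigma> g :: "nat \<Rightarrow> 'a::euclidean_space \<Rightarrow> ennreal" and v :: "'a \<Rightarrow> ennreal" and B :: ennreal
  assumes m: "1 \<le> m"
    and p: "\<And>i. i < m \<Longrightarrow> 1 < p i" "\<And>i. i < m \<Longrightarrow> p i \<le> q"
    and \<sigma> [measurable]: "\<And>i. i < m \<Longrightarrow> \<sigma> i \<in> borel_measurable borel"
    and \<sigma>_fin: "\<And>i C. i < m \<Longrightarrow> cube C \<Longrightarrow> (\<integral>\<^sup>+ y\<in>C. \<sigma> i y \<partial>lborel) < \<infinity>"
    and v [measurable]: "v \<in> borel_measurable borel"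
    and g [measurable]: "\<And>i. i < m \<Longrightarrow> g i \<in> borel_measurable borel"
    and g_fin: "\<And>i. i < m \<Longrightarrow> (\<integral>\<^sup>+ y. epow (g i y) (p i) * \<sigma> i y \<partial>lborel) < \<infinity>"
    and test: "\<And>C. cube C \<Longrightarrow>
      (\<integral>\<^sup>+ x\<in>C. epow (Mfrac m \<alpha> (\<lambda>i y. \<sigma> i y * indicator C y) x) q * v x \<partial>lborel)
        \<le> B * (\<Prod>i<m. epow (\<integral>\<^sup>+ y\<in>C. \<sigma> i y \<partial>lborel) (q / p i))"
begin

text \<open>Linearizing the maximum turns the integral into a Carleson sum for the measures with
  densities \<open>\<sigma> i\<close>, and the testing condition supplies the packing
  hypothesis.\<close>

lemma finite_dyadic_bound:
  assumes F: "finite F" "F \<subseteq> dyadic_grid E"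
  shows "(\<integral>\<^sup>+ x. (SUP Q\<in>F. indicator Q x * epow (frac_avg m \<alpha> (\<lambda>i y. g i y * \<sigma> i y) Q) q) * v x \<partial>lborel)
    \<le> B * (ennreal (embedding_const m p q) *
        (\<Prod>i<m. epow (\<integral>\<^sup>+ y. epow (g i y) (p i) * \<sigma> i y \<partial>lborel) (q / p i)))"
proof -
  have q: "0 < q" using p[of 0] m by force
  define \<mu> where "\<mu> i = density lborel (\<sigma> i)" for i
  have F_sets: "F \<subseteq> sets borel" using F(2) dyadic_grid_sets by auto
  have \<mu>_sets: "sets (\<mu> i) = sets borel" for i by (simp add: \<mu>_def)
  have em: "emeasure (\<mu> i) Q = (\<integral>\<^sup>+ y\<in>Q. \<sigma> i y \<partial>lborel)" if "i < m" "Q \<in> sets borel" for i Q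
    using that by (simp add: \<mu>_def emeasure_density)
  have int_\<mu>: "(\<integral>\<^sup>+ y\<in>Q. g i y \<partial>\<mu> i) = (\<integral>\<^sup>+ y\<in>Q. (g i y * \<sigma> i y) \<partial>lborel)"
    if "i < m" "Q \<in> sets borel" for i Q
    using that by (simp add: \<mu>_def nn_integral_density mult_ac)
  have int_g: "(\<integral>\<^sup>+ y. epow (g i y) (p i) \<partial>\<mu> i) = (\<integral>\<^sup>+ y. epow (g i y) (p i) * \<sigma> i y \<partial>lborel)"
    if "i < m" for i
    using that by (simp add: \<mu>_def nn_integral_density mult_ac)
  define c where "c Q = epow (frac_avg m \<alpha> (\<lambda>i y. g i y * \<sigma> i y) Q) q" for Q
  obtain A where A: "\<And>Q. Q \<in> F \<Longrightarrow> A Q \<in> sets borel" "\<And>Q. Q \<in> F \<Longrightarrow> A Q \<subseteq> Q"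
    "disjoint_family_on A F"
    "\<And>x Q. Q \<in> F \<Longrightarrow> indicator Q x * c Q \<le> (\<Sum>R\<in>F. indicator (A R) x * c R)"
    using linearize_maximum[OF F(1) F_sets, of c] by metis
  \<comment> \<open>What remains of \<open>c Q\<close> times the \<open>v\<close>-mass of
    \<open>A Q\<close> after the \<sigma>-averages of \<open>g\<close> are split off;
    \<open>g\<close> enters it only through the selection \<open>A\<close>.\<close>
  define lam where "lam Q = (\<integral>\<^sup>+ x. indicator (A Q) x * v x \<partial>lborel) * epow (frac_avg m \<alpha> \<sigma> Q) q" for Q
  \<comment> \<open>\<open>test\<close> is available for closed cubes only; the closure of a grid
    cube has the same \<sigma>-mass.\<close>
  have closed: "\<exists>C. cube C \<and> R \<subseteq> C \<and> (\<forall>i<m. (\<integral>\<^sup>+ y\<in>C. \<sigma> i y \<partial>lborel) = emeasure (\<mu> i) R)"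
    if "R \<in> F" for R
  proof -
    have "R \<in> dyadic_grid E" using F(2) that by auto
    then obtain k x where R: "R = dyadic E k x" by (rule dyadic_gridE)
    obtain C where C: "cube C" "R \<subseteq> C" "C - R \<in> null_sets lborel"
      unfolding R by (rule dyadic_closed_cube)
    have "(\<integral>\<^sup>+ y\<in>C. \<sigma> i y \<partial>lborel) = emeasure (\<mu> i) R" if "i < m" for i
    proof -
      have "AE y in lborel. y \<notin> C - R" using C(3) by (rule AE_not_in)
      then have "(\<integral>\<^sup>+ y\<in>C. \<sigma> i y \<partial>lborel) = (\<integral>\<^sup>+ y\<in>R. \<sigma> i y \<partial>lborel)"
        using C(2) by (intro nn_integral_cong_AE) (auto simp: indicator_def)
      then show ?thesis using that by (simp add: em R)
    qed
    then show ?thesis using C by blast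
  qed
  have fin: "emeasure (\<mu> i) R < \<infinity>" if "i < m" "R \<in> F" for i R
    using closed[OF that(2)] \<sigma>_fin[OF that(1)] that(1) by metis
  \<comment> \<open>The Lebesgue integral of \<open>g i * \<sigma> i\<close> is the \<sigma>-mass
    times the \<sigma>-average of \<open>g i\<close>. On a cube of \<sigma>-mass 0 both sides
    vanish.\<close>
  have c_eq: "c Q = epow (frac_avg m \<alpha> \<sigma> Q) q *
      (\<Prod>i<m. epow ((\<integral>\<^sup>+x\<in>Q. g i x \<partial>\<mu> i) / emeasure (\<mu> i) Q) q)" if Q: "Q \<in> F" for Q
  proof -
    have Q_sets [measurable]: "Q \<in> sets borel" using F_sets Q by auto
    have "frac_avg m \<alpha> (\<lambda>i y. g i y * \<sigma> i y) Q =
      frac_avg m \<alpha> \<sigma> Q * (\<Prod>i<m. (\<integral>\<^sup>+x\<in>Q. g i x \<partial>\<mu> i) / emeasure (\<mu> i) Q)"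
      unfolding frac_avg_def prod.distrib[symmetric]
    proof (rule prod.cong)
      fix i assume "i \<in> {..<m}"
      then have i: "i < m" by simp
      have "(\<integral>\<^sup>+x\<in>Q. g i x \<partial>\<mu> i) = emeasure (\<mu> i) Q * ((\<integral>\<^sup>+x\<in>Q. g i x \<partial>\<mu> i) / emeasure (\<mu> i) Q)"
      proof (cases "emeasure (\<mu> i) Q = 0")
        case True
        then have "AE x in \<mu> i. x \<notin> Q" by (intro AE_not_in) (auto simp: \<mu>_sets)
        then have "(\<integral>\<^sup>+x\<in>Q. g i x \<partial>\<mu> i) = (\<integral>\<^sup>+x. 0 \<partial>\<mu> i)"
          by (intro nn_integral_cong_AE) (auto simp: indicator_def)
        then show ?thesis using True by simp
      next
        case False
        then show ?thesis using fin[OF i Q]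
          by (intro ennreal_eq_mult_divide) auto
      qed
      then show "ennreal (measure lborel Q powr (\<alpha> / (real m * real DIM('a)) - 1)) *
          (\<integral>\<^sup>+ y\<in>Q. (g i y * \<sigma> i y) \<partial>lborel) =
        ennreal (measure lborel Q powr (\<alpha> / (real m * real DIM('a)) - 1)) * (\<integral>\<^sup>+ y\<in>Q. \<sigma> i y \<partial>lborel) *
          ((\<integral>\<^sup>+x\<in>Q. g i x \<partial>\<mu> i) / emeasure (\<mu> i) Q)"
        unfolding int_\<mu>[OF i Q_sets] em[OF i Q_sets] mult.assoc by (rule arg_cong)
    qed simp
    then show ?thesis using q by (simp add: c_def epow_mult epow_prod)
  qed
  have "(\<integral>\<^sup>+ x. (SUP Q\<in>F. indicator Q x * c Q) * v x \<partial>lborel)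
    \<le> (\<integral>\<^sup>+ x. (\<Sum>R\<in>F. indicator (A R) x * c R) * v x \<partial>lborel)"
    using A(4) by (intro nn_integral_mono mult_right_mono SUP_least) auto
  also have "\<dots> = (\<Sum>R\<in>F. \<integral>\<^sup>+ x. c R * (indicator (A R) x * v x) \<partial>lborel)"
    unfolding sum_distrib_right using A(1)
    by (subst nn_integral_sum) (auto simp: mult_ac)
  also have "\<dots> = (\<Sum>R\<in>F. c R * (\<integral>\<^sup>+ x. indicator (A R) x * v x \<partial>lborel))"
    using A(1) by (intro sum.cong nn_integral_cmult) auto
  also have "\<dots> = (\<Sum>R\<in>F. lam R * (\<Prod>i<m. epow ((\<integral>\<^sup>+x\<in>R. g i x \<partial>\<mu> i) / emeasure (\<mu> i) R) q))"
    by (intro sum.cong) (auto simp: c_eq lam_def mult_ac)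
  also have "\<dots> \<le> B * (\<Prod>i<m. ennreal (2 powr q * layer_const (p i) powr (q / p i)) *
             epow (\<integral>\<^sup>+x. epow (g i x) (p i) \<partial>\<mu> i) (q / p i))"
  proof (rule multilinear_carleson_embedding)
    fix R assume R: "R \<in> F"
    then obtain C where C: "cube C" "R \<subseteq> C"
      "\<And>i. i < m \<Longrightarrow> (\<integral>\<^sup>+ y\<in>C. \<sigma> i y \<partial>lborel) = emeasure (\<mu> i) R"
      using closed by metis
    let ?G = "{Q\<in>F. Q \<subseteq> R}"
    let ?M = "Mfrac m \<alpha> (\<lambda>i y. \<sigma> i y * indicator C y)"
    have "(\<Sum>Q\<in>?G. lam Q) = (\<Sum>Q\<in>?G. \<integral>\<^sup>+ x. indicator (A Q) x * epow (frac_avg m \<alpha> \<sigma> Q) q * v x \<partial>lborel)"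
      unfolding lam_def using A(1)
      by (intro sum.cong refl) (simp add: nn_integral_cmult[symmetric] mult_ac)
    also have "\<dots> = (\<integral>\<^sup>+ x. (\<Sum>Q\<in>?G. indicator (A Q) x * epow (frac_avg m \<alpha> \<sigma> Q) q) * v x \<partial>lborel)"
      unfolding sum_distrib_right using A(1) by (subst nn_integral_sum) auto
    \<comment> \<open>At most one \<open>A Q\<close> contains \<open>x\<close>, and its cube
      satisfies \<open>Q \<subseteq> R \<subseteq> C\<close>, so its fractional average is at most
      the maximal function of the truncated \<sigma> at \<open>x\<close>.\<close>
    also have "\<dots> \<le> (\<integral>\<^sup>+ x. epow (?M x) q * indicator C x * v x \<partial>lborel)"
    proof (intro nn_integral_mono mult_right_mono sum_indicator_disjoint_le)
      show "disjoint_family_on A ?G"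
        using A(3) by (rule disjoint_family_on_mono[rotated]) auto
      fix x Q assume Q: "Q \<in> ?G" "x \<in> A Q"
      then obtain k y where "Q = dyadic E k y" using F(2) dyadic_gridE by blast
      moreover have "x \<in> Q" "Q \<subseteq> C" using Q A(2) C(2) by auto
      ultimately have "epow (frac_avg m \<alpha> \<sigma> Q) q \<le> epow (?M x) q" "x \<in> C"
        using q by (auto intro!: epow_mono frac_avg_dyadic_le_Mfrac)
      then show "epow (frac_avg m \<alpha> \<sigma> Q) q \<le> epow (?M x) q * indicator C x"
        by (simp only: indicator_simps mult_1_right)
    qed (use F(1) in auto)
    also have "\<dots> = (\<integral>\<^sup>+ x\<in>C. epow (?M x) q * v x \<partial>lborel)"
      by (simp add: mult_ac)
    also have "\<dots> \<le> B * (\<Prod>i<m. epow (\<integral>\<^sup>+ y\<in>C. \<sigma> i y \<partial>lborel) (q / p i))"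
      using C(1) by (rule test)
    also have "\<dots> = B * (\<Prod>i<m. epow (emeasure (\<mu> i) R) (q / p i))"
      using C(3) by simp
    finally show "(\<Sum>Q\<in>?G. lam Q) \<le> B * (\<Prod>i<m. epow (emeasure (\<mu> i) R) (q / p i))" .
  next
    fix Q R assume "Q \<in> F" "R \<in> F"
    then obtain k x l y where "Q = dyadic E k x" "R = dyadic E l y"
      using F(2) dyadic_gridE by (metis subsetD)
    then show "Q \<inter> R = {} \<or> Q \<subseteq> R \<or> R \<subseteq> Q" using dyadic_laminar by metis
  next
    fix i assume "i \<in> {..<m}"
    then show "g i \<in> borel_measurable (\<mu> i)" using g by (simp add: \<mu>_def)
  qed (use m F F_sets \<mu>_sets fin p g_fin int_g in \<open>auto simp: lessThan_empty_iff\<close>)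
  also have "\<dots> = B * (ennreal (embedding_const m p q) *
        (\<Prod>i<m. epow (\<integral>\<^sup>+ y. epow (g i y) (p i) * \<sigma> i y \<partial>lborel) (q / p i)))"
    using int_g by (simp add: embedding_const_def prod.distrib prod_ennreal)
  finally show ?thesis unfolding c_def .
qed

text \<open>Monotone convergence along an enumeration of the countable grid; the finite bound does
  not depend on the number of cubes.\<close>

lemma dyadic_bound:
  "(\<integral>\<^sup>+ x. (SUP Q\<in>dyadic_grid E. indicator Q x * epow (frac_avg m \<alpha> (\<lambda>i y. g i y * \<sigma> i y) Q) q) * v x \<partial>lborel)
    \<le> B * (ennreal (embedding_const m p q) *
        (\<Prod>i<m. epow (\<integral>\<^sup>+ y. epow (g i y) (p i) * \<sigma> i y \<partial>lborel) (q / p i)))"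
proof -
  let ?u = "\<lambda>Q x. indicator Q x * epow (frac_avg m \<alpha> (\<lambda>i y. g i y * \<sigma> i y) Q) q"
  obtain d :: "nat \<Rightarrow> 'a set" where d: "dyadic_grid E = range d"
  proof -
    have "dyadic_grid E \<noteq> {}" by (simp add: dyadic_grid_def)
    from range_from_nat_into[OF this countable_dyadic_grid] that show ?thesis by metis
  qed
  have [measurable]: "d j \<in> sets borel" for j
  proof -
    have "d j \<in> dyadic_grid E" by (simp add: d)
    then show ?thesis by (rule dyadic_grid_sets)
  qed
  have "(SUP Q\<in>dyadic_grid E. ?u Q x) = (SUP N::nat. SUP Q\<in>d ` {..N}. ?u Q x)" for x
    unfolding d image_image
    by (intro antisym SUP_least) (auto intro: SUP_upper2 SUP_upper)
  then have "(\<integral>\<^sup>+ x. (SUP Q\<in>dyadic_grid E. ?u Q x) * v x \<partial>lborel)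
      = (\<integral>\<^sup>+ x. (SUP N::nat. (SUP Q\<in>d ` {..N}. ?u Q x) * v x) \<partial>lborel)"
    by (simp add: SUP_mult_right_ennreal)
  also have "\<dots> = (SUP N::nat. \<integral>\<^sup>+ x. (SUP Q\<in>d ` {..N}. ?u Q x) * v x \<partial>lborel)"
  proof (rule nn_integral_monotone_convergence_SUP)
    show "incseq (\<lambda>(N::nat) x. (SUP Q\<in>d ` {..N}. ?u Q x) * v x)"
      by (intro incseq_SucI le_funI mult_right_mono SUP_subset_mono) auto
    show "(\<lambda>x. (SUP Q\<in>d ` {..N}. ?u Q x) * v x) \<in> borel_measurable lborel" for N :: nat
      unfolding image_image by measurable
  qed
  also have "\<dots> \<le> B * (ennreal (embedding_const m p q) *
        (\<Prod>i<m. epow (\<integral>\<^sup>+ y. epow (g i y) (p i) * \<sigma> i y \<partial>lborel) (q / p i)))"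
    by (intro SUP_least finite_dyadic_bound[where E = E]) (auto simp: d)
  finally show ?thesis .
qed

text \<open>Summation over the shifted grids, one for each subset of the basis, gives the factor
  \<open>2 ^ DIM('a)\<close>.\<close>

lemma Mfrac_bound:
  assumes \<alpha>: "\<alpha> < real m * real DIM('a)"
  shows "(\<integral>\<^sup>+ x. epow (Mfrac m \<alpha> (\<lambda>i y. g i y * \<sigma> i y) x) q * v x \<partial>lborel)
    \<le> ennreal (domination_const DIM('a) m \<alpha> powr q * 2 ^ DIM('a) * embedding_const m p q) *
      (B * (\<Prod>i<m. epow (\<integral>\<^sup>+ y. epow (g i y) (p i) * \<sigma> i y \<partial>lborel) (q / p i)))"
proof -
  let ?u = "\<lambda>E x. SUP Q\<in>dyadic_grid E. indicator Q x * epow (frac_avg m \<alpha> (\<lambda>i y. g i y * \<sigma> i y) Q) q"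
  let ?c = "ennreal (domination_const DIM('a) m \<alpha> powr q)"
  let ?P = "\<Prod>i<m. epow (\<integral>\<^sup>+ y. epow (g i y) (p i) * \<sigma> i y \<partial>lborel) (q / p i)"
  have q: "0 < q" using p[of 0] m by force
  have [measurable]: "?u E \<in> borel_measurable borel" for E
  proof (rule borel_measurable_SUP[OF countable_dyadic_grid])
    fix Q assume "Q \<in> dyadic_grid E"
    then have [measurable]: "Q \<in> sets borel" by (rule dyadic_grid_sets)
    show "(\<lambda>x. indicator Q x * epow (frac_avg m \<alpha> (\<lambda>i y. g i y * \<sigma> i y) Q) q) \<in> borel_measurable borel"
      by measurable
  qed
  have "(\<integral>\<^sup>+ x. epow (Mfrac m \<alpha> (\<lambda>i y. g i y * \<sigma> i y) x) q * v x \<partial>lborel)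
      \<le> (\<integral>\<^sup>+ x. ?c * (\<Sum>E\<in>Pow Basis. ?u E x) * v x \<partial>lborel)"
    using epow_Mfrac_le_dyadic[OF m \<alpha> q] by (intro nn_integral_mono mult_right_mono) auto
  also have "\<dots> = ?c * (\<Sum>E\<in>Pow Basis. \<integral>\<^sup>+ x. ?u E x * v x \<partial>lborel)"
    by (simp add: mult.assoc sum_distrib_right nn_integral_cmult nn_integral_sum)
  also have "\<dots> \<le> ?c * (\<Sum>E\<in>Pow (Basis :: 'a set). B * (ennreal (embedding_const m p q) * ?P))"
    by (intro mult_left_mono sum_mono dyadic_bound) auto
  also have "\<dots> = ennreal (domination_const DIM('a) m \<alpha> powr q * 2 ^ DIM('a) * embedding_const m p q) * (B * ?P)"
    by (simp add: card_Pow ennreal_mult embedding_const_def prod_nonneg mult_ac flip: ennreal_power)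
  finally show ?thesis .
qed

end

subsection \<open>Weights\<close>

text \<open>Local integrability gives measurability of the restrictions to balls, and these converge
  pointwise to \<open>w\<close>.\<close>

lemma weight_measurable:
  fixes w :: "'a::euclidean_space \<Rightarrow> real"
  assumes "weight w"
  shows "w \<in> borel_measurable borel"
proof (rule borel_measurable_LIMSEQ_real)
  fix n :: nat
  have "set_integrable lborel (cball 0 (real n)) w" using assms by (simp add: weight_def)
  then show "(\<lambda>x. indicator (cball 0 (real n)) x *\<^sub>R w x) \<in> borel_measurable borel"
    unfolding set_integrable_def using borel_measurable_integrable by fastforce
next
  fix x :: 'a
  have "eventually (\<lambda>n. norm x \<le> real n) sequentially"
    using filterlim_real_sequentially by (auto simp: filterlim_at_top)
  then have "eventually (\<lambda>n. indicator (cball 0 (real n)) x *\<^sub>R w x = w x) sequentially"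
    by eventually_elim auto
  then show "(\<lambda>n. indicator (cball 0 (real n)) x *\<^sub>R w x) \<longlonglongrightarrow> w x"
    by (rule tendsto_eventually)
qed

lemma weight_cube_finite:
  assumes "weight w" "cube C"
  shows "(\<integral>\<^sup>+ y\<in>C. ennreal (w y) \<partial>lborel) < \<infinity>"
proof -
  have "compact C" using assms(2) by (auto simp: cube_def)
  then have "integrable lborel (\<lambda>y. indicator C y *\<^sub>R w y)"
    using assms(1) by (simp add: weight_def set_integrable_def)
  then have "(\<integral>\<^sup>+ y. ennreal (indicator C y *\<^sub>R w y) \<partial>lborel) < \<infinity>"
    using assms(1) by (subst nn_integral_eq_integral) (auto simp: weight_def)
  also have "(\<integral>\<^sup>+ y. ennreal (indicator C y *\<^sub>R w y) \<partial>lborel) = (\<integral>\<^sup>+ y\<in>C. ennreal (w y) \<partial>lborel)"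
    by (intro nn_integral_cong) (auto simp: indicator_def)
  finally show ?thesis .
qed

lemma sigw_exponent: "1 < p \<Longrightarrow> 1 - dualexp p = - 1 / (p - 1)"
  by (simp add: dualexp_def field_simps)

lemma sigw_pos: "0 < w x \<Longrightarrow> 0 < sigw p w x"
  by (simp add: sigw_def)

text \<open>The exponent \<open>a = - 1 / (p - 1)\<close> solves \<open>a * p + 1 = a\<close>. Thus
  the substitution \<open>f = g * \<sigma>\<close> turns the weighted power of \<open>f\<close> into
  that of \<open>g\<close> with weight \<sigma>.\<close>

lemma sigw_power_mult:
  assumes "1 < p" "0 < w x"
  shows "sigw p w x powr p * w x = sigw p w x"
proof -
  define a where "a = - 1 / (p - 1)"
  have "sigw p w x = w x powr a" using assms by (simp add: sigw_def sigw_exponent a_def)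
  moreover have "(w x powr a) powr p * w x = w x powr (a * p + 1)"
    using assms by (simp add: powr_powr powr_add)
  moreover have "a * p + 1 = a" using assms by (simp add: a_def field_simps)
  ultimately show ?thesis by simp
qed

lemma ennreal_divide_le_of_le_mult: "x \<le> c * y \<Longrightarrow> x / y \<le> (c :: ennreal)"
proof (cases "y = 0 \<or> y = top")
  \<comment> \<open>Division by \<open>top\<close> gives 0. For \<open>y = 0\<close> the hypothesis
    forces \<open>x = 0\<close>, and \<open>0 / 0 = 0\<close>.\<close>
  case True
  assume "x \<le> c * y"
  then show ?thesis using True by auto
next
  case False
  assume "x \<le> c * y"
  then have "x / y \<le> c * y / y" by (rule divide_right_mono_ennreal)
  also have "\<dots> = c" using False by (simp add: ennreal_mult_divide_eq)
  finally show ?thesis .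
qed

lemma ennreal_le_mult_of_divide_le:
  assumes "x / y \<le> (c :: ennreal)" "c < top" "y < top"
  shows "x \<le> c * y"
proof (cases "y = 0")
  case True
  \<comment> \<open>A nonzero \<open>x\<close> divided by 0 would be \<open>top\<close>, against
    \<open>c < top\<close>.\<close>
  then have "x = 0" using assms by (auto simp: ennreal_divide_zero top_unique split: if_splits)
  then show ?thesis by simp
next
  case False
  have "x = x / y * y"
    by (subst mult.commute) (rule ennreal_eq_mult_divide[OF False assms(3)])
  also have "\<dots> \<le> c * y" by (intro mult_right_mono assms) simp
  finally show ?thesis .
qed

section \<open>The two inequalities between testing constant and operator norm\<close>

lemma Sconst_le_Mnorm:
  fixes w :: "nat \<Rightarrow> 'a::euclidean_space \<Rightarrow> real" and v :: "'a \<Rightarrow> real"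
  assumes p: "\<And>i. i < m \<Longrightarrow> 1 < p i" and q: "0 < q"
    and w: "\<And>i. i < m \<Longrightarrow> AE x in lborel. 0 < w i x"
      "\<And>i. i < m \<Longrightarrow> weight (sigw (p i) (w i))"
  shows "Sconst m \<alpha> p q w v \<le> Mnorm m \<alpha> p q w v"
  unfolding Mnorm_def
proof (intro Inf_greatest)
  fix C assume "C \<in> {C. \<forall>f::nat \<Rightarrow> 'a \<Rightarrow> real.
      (\<forall>i<m. f i \<in> borel_measurable lborel
          \<and> Lpnorm (p i) (w i) (\<lambda>x. ennreal \<bar>f i x\<bar>) < \<infinity>) \<longrightarrow>
      Lpnorm q v (Mfrac m \<alpha> (\<lambda>i x. ennreal \<bar>f i x\<bar>))
        \<le> C * (\<Prod>i<m. Lpnorm (p i) (w i) (\<lambda>x. ennreal \<bar>f i x\<bar>))}"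
  then have C: "Lpnorm q v (Mfrac m \<alpha> (\<lambda>i x. ennreal \<bar>f i x\<bar>))
        \<le> C * (\<Prod>i<m. Lpnorm (p i) (w i) (\<lambda>x. ennreal \<bar>f i x\<bar>))"
    if "\<And>i. i < m \<Longrightarrow> f i \<in> borel_measurable lborel"
      "\<And>i. i < m \<Longrightarrow> Lpnorm (p i) (w i) (\<lambda>x. ennreal \<bar>f i x\<bar>) < \<infinity>"
    for f :: "nat \<Rightarrow> 'a \<Rightarrow> real"
    using that by blast
  show "Sconst m \<alpha> p q w v \<le> C"
    unfolding Sconst_def
  proof (intro SUP_least ennreal_divide_le_of_le_mult)
    fix Q :: "'a set" assume "Q \<in> {Q. cube Q}"
    then have Q: "cube Q" by simp
    then have [measurable]: "Q \<in> sets borel" by (auto simp: cube_def)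
    \<comment> \<open>The test function attached to \<open>Q\<close>; by
      \<open>sigw_power_mult\<close> the \<open>p i\<close>-th power of its norm is the
      \<sigma>-mass of \<open>Q\<close>.\<close>
    define f where "f i y = sigw (p i) (w i) y * indicator Q y" for i y
    have abs_f: "\<bar>f i y\<bar> = f i y" for i y
      by (auto simp: f_def sigw_def indicator_def)
    have norm: "Lpnorm (p i) (w i) (\<lambda>x. ennreal \<bar>f i x\<bar>)
        = epow (\<integral>\<^sup>+ x\<in>Q. ennreal (sigw (p i) (w i) x) \<partial>lborel) (1 / p i)" if i: "i < m" for i
      unfolding Lpnorm_def
    proof (intro arg_cong2[where f = epow] nn_integral_cong_AE)
      show "AE x in lborel. epow (ennreal \<bar>f i x\<bar>) (p i) * ennreal (w i x)
          = ennreal (sigw (p i) (w i) x) * indicator Q x"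
        using w(1)[OF i]
      proof eventually_elim
        case (elim x)
        then show ?case
          using sigw_power_mult[of "p i" "w i" x] sigw_pos[of "w i" x "p i"] p[OF i]
          by (auto simp: f_def indicator_def epow_ennreal simp flip: ennreal_mult)
      qed
    qed simp
    have le: "Lpnorm q v (Mfrac m \<alpha> (\<lambda>i x. ennreal \<bar>f i x\<bar>))
        \<le> C * (\<Prod>i<m. Lpnorm (p i) (w i) (\<lambda>x. ennreal \<bar>f i x\<bar>))"
    proof (rule C)
      fix i assume i: "i < m"
      have [measurable]: "sigw (p i) (w i) \<in> borel_measurable borel"
        using w(2)[OF i] by (rule weight_measurable)
      show "f i \<in> borel_measurable lborel" unfolding f_def by measurable
      show "Lpnorm (p i) (w i) (\<lambda>x. ennreal \<bar>f i x\<bar>) < \<infinity>"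
        using weight_cube_finite[OF w(2)[OF i] Q] by (auto simp: norm[OF i] intro!: epow_less_top)
    qed
    \<comment> \<open>The testing quantity integrates over \<open>Q\<close> only, the norm over the
      whole space.\<close>
    have "epow (\<integral>\<^sup>+ x\<in>Q. epow (Mfrac m \<alpha> (\<lambda>i y. ennreal (sigw (p i) (w i) y * indicator Q y)) x) q
        * ennreal (v x) \<partial>lborel) (1 / q) \<le> Lpnorm q v (Mfrac m \<alpha> (\<lambda>i x. ennreal \<bar>f i x\<bar>))"
      unfolding Lpnorm_def abs_f unfolding f_def using q
      by (intro epow_mono nn_integral_mono) (auto simp: indicator_def)
    also note le
    also have "C * (\<Prod>i<m. Lpnorm (p i) (w i) (\<lambda>x. ennreal \<bar>f i x\<bar>))
        = C * (\<Prod>i<m. epow (\<integral>\<^sup>+ x\<in>Q. ennreal (sigw (p i) (w i) x) \<partial>lborel) (1 / p i))"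
      using norm by simp
    finally show "epow (\<integral>\<^sup>+ x\<in>Q. epow (Mfrac m \<alpha> (\<lambda>i y. ennreal (sigw (p i) (w i) y * indicator Q y)) x) q
        * ennreal (v x) \<partial>lborel) (1 / q)
        \<le> C * (\<Prod>i<m. epow (\<integral>\<^sup>+ x\<in>Q. ennreal (sigw (p i) (w i) x) \<partial>lborel) (1 / p i))" .
  qed
qed

text \<open>Supplies the hypothesis \<open>test\<close> with \<open>B\<close> the
  \<open>q\<close>-th power of the testing constant. Finiteness of the constant and of the
  \<sigma>-masses allows the quotient to be multiplied out.\<close>

lemma Sconst_testing:
  fixes w :: "nat \<Rightarrow> 'a::euclidean_space \<Rightarrow> real" and v :: "'a \<Rightarrow> real"
  assumes q: "0 < q"
    and w: "\<And>i. i < m \<Longrightarrow> weight (sigw (p i) (w i))"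
    and S: "Sconst m \<alpha> p q w v < top" and C: "cube C"
  shows "(\<integral>\<^sup>+ x\<in>C. epow (Mfrac m \<alpha> (\<lambda>i y. ennreal (sigw (p i) (w i) y) * indicator C y) x) q * ennreal (v x) \<partial>lborel)
    \<le> epow (Sconst m \<alpha> p q w v) q * (\<Prod>i<m. epow (\<integral>\<^sup>+ y\<in>C. ennreal (sigw (p i) (w i) y) \<partial>lborel) (q / p i))"
proof -
  let ?I = "\<integral>\<^sup>+ x\<in>C. epow (Mfrac m \<alpha> (\<lambda>i y. ennreal (sigw (p i) (w i) y) * indicator C y) x) q * ennreal (v x) \<partial>lborel"
  let ?P = "\<Prod>i<m. epow (\<integral>\<^sup>+ y\<in>C. ennreal (sigw (p i) (w i) y) \<partial>lborel) (1 / p i)"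
  have eq: "ennreal (s * indicator Q y) = ennreal s * indicator Q y" for s y and Q :: "'a set"
    by (simp add: indicator_def)
  have "epow ?I (1 / q) / ?P \<le> Sconst m \<alpha> p q w v"
    unfolding Sconst_def eq using C by (intro SUP_upper) simp
  moreover have "?P < top"
    using weight_cube_finite[OF w C]
    by (auto simp: less_top[symmetric] ennreal_prod_eq_top)
  ultimately have "epow ?I (1 / q) \<le> Sconst m \<alpha> p q w v * ?P"
    using S by (intro ennreal_le_mult_of_divide_le)
  then have "?I \<le> epow (Sconst m \<alpha> p q w v * ?P) q"
    using q by (subst (asm) epow_le_iff) auto
  then show ?thesis using q by (simp add: epow_mult epow_prod epow_epow)
qed

lemma Mnorm_le_Sconst:
  fixes w :: "nat \<Rightarrow> 'a::euclidean_space \<Rightarrow> real" and v :: "'a \<Rightarrow> real"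
  assumes m: "1 \<le> m" and \<alpha>: "\<alpha> < real m * real DIM('a)"
    and p: "\<And>i. i < m \<Longrightarrow> 1 < p i" "\<And>i. i < m \<Longrightarrow> p i \<le> q"
    and w: "\<And>i. i < m \<Longrightarrow> AE x in lborel. 0 < w i x"
      "\<And>i. i < m \<Longrightarrow> weight (sigw (p i) (w i))" and v: "weight v"
  shows "Mnorm m \<alpha> p q w v \<le> ennreal ((domination_const DIM('a) m \<alpha> powr q * 2 ^ DIM('a) *
      embedding_const m p q) powr (1 / q)) * Sconst m \<alpha> p q w v"
    (is "_ \<le> ennreal (?K powr _) * ?S")
proof -
  have q: "0 < q" using p[of 0] m by force
  have K: "0 < ?K" "0 < ?K powr (1 / q)"
    using domination_const_pos[of "DIM('a)" m \<alpha>] embedding_const_pos[of m p q] p(1) by auto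
  show ?thesis
  proof (cases "?S = top")
    case True
    have "ennreal (?K powr (1 / q)) * top = top" using K(2) by (rule ennreal_mult_top_pos)
    then show ?thesis by (simp only: True top_greatest)
  next
    case False
    show ?thesis
      unfolding Mnorm_def
    proof (intro Inf_lower CollectI allI impI)
      fix f :: "nat \<Rightarrow> 'a \<Rightarrow> real"
      assume "\<forall>i<m. f i \<in> borel_measurable lborel \<and> Lpnorm (p i) (w i) (\<lambda>x. ennreal \<bar>f i x\<bar>) < \<infinity>"
      then have f: "\<And>i. i < m \<Longrightarrow> f i \<in> borel_measurable borel"
        "\<And>i. i < m \<Longrightarrow> Lpnorm (p i) (w i) (\<lambda>x. ennreal \<bar>f i x\<bar>) < \<infinity>" by auto
      define \<sigma> where "\<sigma> i x = ennreal (sigw (p i) (w i) x)" for i x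
      \<comment> \<open>The quotient is taken in the reals, with value 0 where \<sigma> vanishes;
        that happens only on a null set.\<close>
      define g where "g i x = ennreal (\<bar>f i x\<bar> / sigw (p i) (w i) x)" for i x
      have sigw_meas: "sigw (p i) (w i) \<in> borel_measurable borel" if "i < m" for i
        using w(2)[OF that] by (rule weight_measurable)
      have g_eq: "AE x in lborel. ennreal \<bar>f i x\<bar> = g i x * \<sigma> i x" if i: "i < m" for i
        using w(1)[OF i]
      proof eventually_elim
        case (elim x)
        then show ?case using sigw_pos[of "w i" x "p i"]
          by (simp add: g_def \<sigma>_def flip: ennreal_mult)
      qed
      \<comment> \<open>The maximal function sees its arguments only through integrals, so almost
        everywhere equality gives equality at every point.\<close>
      have "Mfrac m \<alpha> (\<lambda>i x. ennreal \<bar>f i x\<bar>) = Mfrac m \<alpha> (\<lambda>i x. g i x * \<sigma> i x)"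
        unfolding Mfrac_eq using frac_avg_cong[OF g_eq] by auto
      have norm: "Lpnorm (p i) (w i) (\<lambda>x. ennreal \<bar>f i x\<bar>)
          = epow (\<integral>\<^sup>+ x. epow (g i x) (p i) * \<sigma> i x \<partial>lborel) (1 / p i)" if i: "i < m" for i
        unfolding Lpnorm_def
      proof (intro arg_cong2[where f = epow] nn_integral_cong_AE)
        show "AE x in lborel. epow (ennreal \<bar>f i x\<bar>) (p i) * ennreal (w i x) = epow (g i x) (p i) * \<sigma> i x"
          using w(1)[OF i]
        proof eventually_elim
          case (elim x)
          let ?s = "sigw (p i) (w i) x"
          have s: "0 < ?s" using elim by (rule sigw_pos)
          have "(\<bar>f i x\<bar> / ?s) powr p i * ?s = (\<bar>f i x\<bar> / ?s) powr p i * (?s powr p i * w i x)"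
            using sigw_power_mult[of "p i" "w i" x] elim p(1)[OF i] by simp
          also have "\<dots> = \<bar>f i x\<bar> powr p i * w i x"
            using s by (simp add: powr_divide)
          finally show ?case using s elim
            by (simp add: g_def \<sigma>_def epow_ennreal flip: ennreal_mult)
        qed
      qed simp
      have g_fin: "(\<integral>\<^sup>+ x. epow (g i x) (p i) * \<sigma> i x \<partial>lborel) < \<infinity>" if "i < m" for i
        using epow_less_top[of "Lpnorm (p i) (w i) (\<lambda>x. ennreal \<bar>f i x\<bar>)" "p i"] f(2)[OF that] p(1)[OF that]
        by (simp add: norm[OF that] epow_epow)
      have "(\<integral>\<^sup>+ x. epow (Mfrac m \<alpha> (\<lambda>i x. g i x * \<sigma> i x) x) q * ennreal (v x) \<partial>lborel)
        \<le> ennreal ?K * (epow ?S q * (\<Prod>i<m. epow (\<integral>\<^sup>+ y. epow (g i y) (p i) * \<sigma> i y \<partial>lborel) (q / p i)))"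
      proof (rule Mfrac_bound[OF m p])
        show "(\<integral>\<^sup>+ x\<in>C. epow (Mfrac m \<alpha> (\<lambda>i y. \<sigma> i y * indicator C y) x) q * ennreal (v x) \<partial>lborel)
          \<le> epow ?S q * (\<Prod>i<m. epow (\<integral>\<^sup>+ y\<in>C. \<sigma> i y \<partial>lborel) (q / p i))" if "cube C" for C
          unfolding \<sigma>_def using p q w(2) False that by (intro Sconst_testing) (auto simp: less_top)
        show "\<sigma> i \<in> borel_measurable borel" if "i < m" for i
          unfolding \<sigma>_def using sigw_meas[OF that] by measurable
        show "g i \<in> borel_measurable borel" if "i < m" for i
          unfolding g_def using sigw_meas[OF that] f(1)[OF that] by measurable
        show "(\<lambda>x. ennreal (v x)) \<in> borel_measurable borel"
          using weight_measurable[OF v] by measurable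
        show "(\<integral>\<^sup>+ y\<in>C. \<sigma> i y \<partial>lborel) < \<infinity>" if "i < m" "cube C" for i C
          unfolding \<sigma>_def using weight_cube_finite[OF w(2)] that by blast
      qed (use g_fin \<alpha> in auto)
      then have "Lpnorm q v (Mfrac m \<alpha> (\<lambda>i x. ennreal \<bar>f i x\<bar>))
        \<le> epow (ennreal ?K * (epow ?S q *
            (\<Prod>i<m. epow (\<integral>\<^sup>+ y. epow (g i y) (p i) * \<sigma> i y \<partial>lborel) (q / p i)))) (1 / q)"
        unfolding Lpnorm_def \<open>Mfrac m \<alpha> (\<lambda>i x. ennreal \<bar>f i x\<bar>) = _\<close>
        using q by (intro epow_mono) auto
      also have "\<dots> = ennreal (?K powr (1 / q)) * (?S *
            (\<Prod>i<m. epow (\<integral>\<^sup>+ y. epow (g i y) (p i) * \<sigma> i y \<partial>lborel) (1 / p i)))"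
        using q K by (simp add: epow_mult epow_prod epow_epow epow_ennreal less_imp_le)
      also have "\<dots> = ennreal (?K powr (1 / q)) * ?S * (\<Prod>i<m. Lpnorm (p i) (w i) (\<lambda>x. ennreal \<bar>f i x\<bar>))"
        using norm by (simp add: mult.assoc)
      finally show "Lpnorm q v (Mfrac m \<alpha> (\<lambda>i x. ennreal \<bar>f i x\<bar>))
        \<le> ennreal (?K powr (1 / q)) * ?S * (\<Prod>i<m. Lpnorm (p i) (w i) (\<lambda>x. ennreal \<bar>f i x\<bar>))" .
    qed
  qed
qed

text \<open>Both constants are quantified before the weights, which expresses uniformity. As they
  are positive and finite, the norm is finite exactly when the testing constant is, so boundedness
  is covered too.\<close>

theorem theorem1p1:
  fixes m :: nat and \<alpha> q :: real and p :: "nat \<Rightarrow> real"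
  assumes "m \<ge> 1"
    and "0 \<le> \<alpha>" and "\<alpha> < real m * real DIM('a::euclidean_space)"
    and "\<forall>i<m. 1 < p i"
    and "1 / q = (\<Sum>i<m. 1 / p i) - \<alpha> / real DIM('a)"
    and "\<forall>i<m. p i \<le> q"
  shows "\<exists>C1 C2 :: real. 0 < C1 \<and> 0 < C2 \<and>
    (\<forall>(w :: nat \<Rightarrow> 'a \<Rightarrow> real) (v :: 'a \<Rightarrow> real).
       (\<forall>i<m. weight (w i) \<and> (AE x in lborel. 0 < w i x) \<and> weight (sigw (p i) (w i)))
       \<and> weight v \<longrightarrow>
       ennreal C1 * Sconst m \<alpha> p q w v \<le> Mnorm m \<alpha> p q w v
       \<and> Mnorm m \<alpha> p q w v \<le> ennreal C2 * Sconst m \<alpha> p q w v)"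
proof -
  \<comment> \<open>Built from the dimension, \<open>m\<close>, \<alpha>, \<open>p\<close> and
    \<open>q\<close> alone.\<close>
  let ?K = "domination_const DIM('a) m \<alpha> powr q * 2 ^ DIM('a) * embedding_const m p q"
  have q: "0 < q" using assms by force
  have K: "0 < ?K powr (1 / q)"
    using domination_const_pos[of "DIM('a)" m \<alpha>] embedding_const_pos[of m p q] assms(4) by auto
  have "ennreal 1 * Sconst m \<alpha> p q w v \<le> Mnorm m \<alpha> p q w v
       \<and> Mnorm m \<alpha> p q w v \<le> ennreal (?K powr (1 / q)) * Sconst m \<alpha> p q w v"
    if "\<forall>i<m. weight (w i) \<and> (AE x in lborel. 0 < w i x) \<and> weight (sigw (p i) (w i))" "weight v"
    for w :: "nat \<Rightarrow> 'a \<Rightarrow> real" and v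
    using Sconst_le_Mnorm[of m p q w \<alpha> v] Mnorm_le_Sconst[of m \<alpha> p q w v] assms q that by simp
  then show ?thesis using K by (intro exI[of _ 1] exI[of _ "?K powr (1 / q)"]) auto
qed

end
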